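(* Let $G_1,G_2$ be separable locally compact groups, each admitting an invariant metric. Let $X_1\subseteq G_1$ and $X_2\subseteq G_2$. (i) If $X_1$ has strong measure zero and $X_2$ is $\mathcal M$-additive in $G_2$, then $X_1\times X_2$ has strong measure zero in $G_1\times G_2$. (ii) If $X_1$ is $\mathcal M$-additive in $G_1$ and $X_2$ is $\mathcal M$-additive in $G_2$, then $X_1\times X_2$ is $\mathcal M$-additive in $G_1\times G_2$.
   Context: An invariant metric is a metric compatible with the topology that is both left- and right-invariant. A set is meager if it is a countable union of nowhere dense sets. For a Polish group $G$, a set $X\subseteq G$ is $\mathcal M$-additive (meager-additive) if $MX=\{mx:m\in M,x\in X\}$ is meager for every meager set $M\subseteq G$. $G_1\times G_2$ is the product group with the product topology. A metric space $X$ (or a subset of a metric space, with the restricted metric) has strong measure zero if for every sequence $\langle\varepsilon_n\rangle$ of positive reals there is a cover $\{U_n:n\in\omega\}$ of $X$ with $\operatorname{diam}U_n\leq\varepsilon_n$ for all $n$. In (i), strong measure zero is taken with respect to metrics compatible with the topologies (in separable locally compact metrizable spaces the notion does not depend on the choice of such a metric). *)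

theory Defs
  imports "HOL-Analysis.Analysis" "HOL-Algebra.Coset"
begin

locale topological_group = group G for G (structure) +
  fixes T :: "'a topology"
  assumes topspace_eq: "topspace T = carrier G"
    and continuous_mult: "continuous_map (prod_topology T T) T (\<lambda>(x, y). x \<otimes> y)"
    and continuous_inv: "continuous_map T T (\<lambda>x. inv x)"

definition compatible_metric :: "'a topology \<Rightarrow> 'a metric \<Rightarrow> bool" where
  "compatible_metric T m \<longleftrightarrow> mtopology_of m = T"

definition invariant_metric :: "('a, 'c) monoid_scheme \<Rightarrow> 'a topology \<Rightarrow> 'a metric \<Rightarrow> bool" where
  "invariant_metric G T m \<longleftrightarrow>
     compatible_metric T m \<and>
     (\<forall>x\<in>carrier G. \<forall>y\<in>carrier G. \<forall>z\<in>carrier G.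
        mdist m (z \<otimes>\<^bsub>G\<^esub> x) (z \<otimes>\<^bsub>G\<^esub> y) = mdist m x y \<and>
        mdist m (x \<otimes>\<^bsub>G\<^esub> z) (y \<otimes>\<^bsub>G\<^esub> z) = mdist m x y)"

definition nowhere_dense_in :: "'a topology \<Rightarrow> 'a set \<Rightarrow> bool" where
  "nowhere_dense_in T S \<longleftrightarrow> S \<subseteq> topspace T \<and> T interior_of (T closure_of S) = {}"

definition meager_in :: "'a topology \<Rightarrow> 'a set \<Rightarrow> bool" where
  "meager_in T S \<longleftrightarrow> (\<exists>N :: nat \<Rightarrow> 'a set. (\<forall>n. nowhere_dense_in T (N n)) \<and> S = (\<Union>n. N n))"

definition meager_additive :: "('a, 'c) monoid_scheme \<Rightarrow> 'a topology \<Rightarrow> 'a set \<Rightarrow> bool" where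
  "meager_additive G T X \<longleftrightarrow>
     X \<subseteq> carrier G \<and> (\<forall>M. meager_in T M \<longrightarrow> meager_in T (M <#>\<^bsub>G\<^esub> X))"

text \<open>
  The diameter takes values in the extended nonnegative reals: it is infinite for unbounded sets
  (the library's \<open>diameter\<close> is unspecified there) and 0 for the empty set.
\<close>
definition mdiameter :: "'a metric \<Rightarrow> 'a set \<Rightarrow> ennreal" where
  "mdiameter m U = (SUP x\<in>U. SUP y\<in>U. ennreal (mdist m x y))"

text \<open>
  \<open>X\<close> is regarded as a metric space in its own right, so the covering sets are subsets of \<open>X\<close>.
\<close>
definition strong_measure_zero :: "'a metric \<Rightarrow> 'a set \<Rightarrow> bool" where
  "strong_measure_zero m X \<longleftrightarrow>
     X \<subseteq> mspace m \<and>
     (\<forall>\<epsilon> :: nat \<Rightarrow> real. (\<forall>n. \<epsilon> n > 0) \<longrightarrow>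
        (\<exists>U :: nat \<Rightarrow> 'a set. (\<forall>n. mdiameter m (U n) \<le> ennreal (\<epsilon> n)) \<and> (\<Union>n. U n) = X))"

end

theory Submission
  imports Defs
begin

text \<open>
  Both parts go through a covering property that is between strong measure zero and countability.
  A set \<open>X\<close> has sharp measure zero if for all positive \<open>\<epsilon>\<^sub>n\<close> there are sets \<open>U\<^sub>n\<close> of diameter at most \<open>\<epsilon>\<^sub>n\<close> and a
  division of the indices into consecutive finite blocks such that every point of \<open>X\<close> is covered
  within all but finitely many blocks. Strong measure zero only gives a point infinitely many
  \<open>U\<^sub>n\<close>; here it is caught once in almost every block.

  Products are easy for this notion. If blocks \<open>I\<^sub>l\<close> of a cover \<open>U\<close> of a factor of sharp measure zero
  are already known, choose the cover \<open>V\<close> of the other factor with the diameter of \<open>V\<^sub>l\<close> below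
  all \<open>\<epsilon>\<^sub>n\<close> with \<open>n \<in> I\<^sub>l\<close>, and use the sets \<open>U\<^sub>n \<times> V\<^sub>l\<close> for \<open>n \<in> I\<^sub>l\<close>. They are indexed by \<open>n\<close> alone, so no
  diameter has to be paid for the product of two index sets. If a second point lies in infinitely
  many \<open>V\<^sub>l\<close>, then one of these \<open>l\<close> is a block that covers the first point
  (\<open>strong_measure_zero_Times_sharp\<close>); if \<open>V\<close> has blocks of its own, their unions of blocks \<open>I\<^sub>l\<close> are blocks
  for the product (\<open>sharp_measure_zero_Times\<close>).

  It remains that in a separable locally compact group with an invariant metric the sets of
  sharp measure zero are exactly the meager-additive ones.

  If \<open>X\<close> has sharp measure zero and \<open>M\<close> is meager, cover \<open>M\<close> by an increasing sequence of compact nowhere dense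
  sets \<open>P\<^sub>k\<close>. By invariance all translates of \<open>P\<^sub>k\<close> are equally thin: there is a radius \<open>\<rho>\<^sub>k\<^sub>+\<^sub>1\<close> such that
  every ball of radius \<open>\<rho>\<^sub>k\<close> contains one of radius \<open>\<rho>\<^sub>k\<^sub>+\<^sub>1\<close> that misses \<open>P\<^sub>k U\<close>, for every set \<open>U\<close> of
  diameter at most \<open>\<rho>\<^sub>k\<^sub>+\<^sub>1\<close>. A cover for \<open>\<epsilon>\<^sub>n = \<rho>\<^sub>n\<^sub>+\<^sub>1\<close> then lets one run through a whole block and find a
  ball that misses \<open>P\<^sub>j U\<^sub>n\<close> for all \<open>n\<close> of the block. Hence \<open>P\<^sub>j\<close> times the set of points that are covered
  in all blocks from the \<open>j\<close>-th on is nowhere dense, and \<open>MX\<close> is a union of such sets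
  (\<open>sharp_measure_zero_imp_meager_additive\<close>).

  Conversely let \<open>X\<close> be meager-additive. If the group is discrete it is countable, and countable
  sets have sharp measure zero. Otherwise take a dense sequence \<open>p\<^sub>k\<close>, radii \<open>r\<^sub>k\<close> that shrink fast,
  and the nowhere dense complement \<open>N\<close> of the balls around \<open>p\<^sub>k\<close> of radius \<open>r\<^sub>k\<^sub>+\<^sub>1\<close>. Then \<open>NX\<close> is covered
  by increasing nowhere dense sets \<open>F\<^sub>i\<close>. For the \<open>i\<close>-th block, which starts at \<open>l\<close>, choose in each of finitely
  many balls of radius \<open>r\<^sub>l / 2\<close> that cover a large compact set a smaller ball, of centre \<open>c\<close>, that misses \<open>F\<^sub>i\<close>;
  the block ends as soon as the \<open>r\<^sub>k\<close> are below the radii of these balls. The covering sets are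
  the balls of radius \<open>2 r\<^sub>k\<^sub>+\<^sub>1\<close> around \<open>p\<^sub>k\<inverse> c\<close>. Now suppose that \<open>x \<in> X\<close> is missed in infinitely many
  blocks. For a missed block a suitable \<open>c x\<inverse>\<close> is far from all \<open>p\<^sub>k\<close> of the block, and all
  points near it are multiplied by \<open>x\<close> outside \<open>F\<^sub>i\<close>. Nested balls around such points, with any points far
  from the \<open>p\<^sub>k\<close> for the other blocks, converge to some \<open>z \<in> N\<close> with \<open>z x\<close> outside all \<open>F\<^sub>i\<close>, which is absurd
  (\<open>translate_escapes\<close>, \<open>meager_additive_imp_sharp_measure_zero\<close>).

  In the first part the metrics are arbitrary. The product of the metric given on the first group
  with an invariant metric of the second is exchanged at the end for the metric given on the
  product. The groups are countable unions of compact balls, on compact sets two metrics with the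
  same topology are uniformly equivalent, and strong measure zero can be checked on countably many
  pieces (\<open>strong_measure_zero_change_metric\<close>).
\<close>

section \<open>Strong and sharp measure zero\<close>

definition diam_le :: "'a metric \<Rightarrow> real \<Rightarrow> 'a set \<Rightarrow> bool" where
  "diam_le m r U \<longleftrightarrow> (\<forall>x\<in>U. \<forall>y\<in>U. mdist m x y \<le> r)"

lemma diam_leD: "diam_le m r U \<Longrightarrow> x \<in> U \<Longrightarrow> y \<in> U \<Longrightarrow> mdist m x y \<le> r"
  by (auto simp: diam_le_def)

lemma diam_le_subset: "diam_le m r U \<Longrightarrow> V \<subseteq> U \<Longrightarrow> diam_le m r V"
  by (auto simp: diam_le_def)

lemma mdiameter_le_iff:
  assumes "0 \<le> r"
  shows "mdiameter m U \<le> ennreal r \<longleftrightarrow> diam_le m r U"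
  using assms by (simp add: mdiameter_def SUP_le_iff diam_le_def ennreal_le_iff)

text \<open>
  Replacing equality by inclusion leaves the notion unchanged, because a cover can be intersected
  with the set. In this form it needs no care about where the covering sets lie.
\<close>

lemma strong_measure_zero_iff:
  "strong_measure_zero m X \<longleftrightarrow>
     X \<subseteq> mspace m \<and>
     (\<forall>\<epsilon>. (\<forall>n. 0 < \<epsilon> n) \<longrightarrow> (\<exists>U :: nat \<Rightarrow> 'a set. (\<forall>n. diam_le m (\<epsilon> n) (U n)) \<and> X \<subseteq> (\<Union>n. U n)))"
  (is "_ \<longleftrightarrow> _ \<and> ?R")
proof -
  have "(\<forall>\<epsilon> :: nat \<Rightarrow> real. (\<forall>n. \<epsilon> n > 0) \<longrightarrow>
        (\<exists>U :: nat \<Rightarrow> 'a set. (\<forall>n. mdiameter m (U n) \<le> ennreal (\<epsilon> n)) \<and> (\<Union>n. U n) = X)) \<longleftrightarrow> ?R"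
    (is "?L \<longleftrightarrow> _")
  proof
    assume L: ?L
    show ?R
    proof (intro allI impI)
      fix \<epsilon> :: "nat \<Rightarrow> real" assume e: "\<forall>n. 0 < \<epsilon> n"
      then obtain U where "\<forall>n. mdiameter m (U n) \<le> ennreal (\<epsilon> n)" "(\<Union>n. U n) = X"
        using L by blast
      then show "\<exists>U. (\<forall>n. diam_le m (\<epsilon> n) (U n)) \<and> X \<subseteq> (\<Union>n. U n)"
        using mdiameter_le_iff[OF less_imp_le] e by (intro exI[of _ U]) blast
    qed
  next
    assume R: ?R
    show ?L
    proof (intro allI impI)
      fix \<epsilon> :: "nat \<Rightarrow> real" assume e: "\<forall>n. 0 < \<epsilon> n"
      then obtain U where U: "\<forall>n. diam_le m (\<epsilon> n) (U n)" "X \<subseteq> (\<Union>n. U n)"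
        using R by blast
      have "mdiameter m (U n \<inter> X) \<le> ennreal (\<epsilon> n)" for n
        using mdiameter_le_iff[of "\<epsilon> n" m "U n \<inter> X"] e diam_le_subset[of m "\<epsilon> n" "U n" "U n \<inter> X"] U(1)
        by (simp add: less_imp_le)
      moreover have "(\<Union>n. U n \<inter> X) = X"
        using U(2) by blast
      ultimately show "\<exists>U. (\<forall>n. mdiameter m (U n) \<le> ennreal (\<epsilon> n)) \<and> (\<Union>n. U n) = X"
        by (intro exI[of _ "\<lambda>n. U n \<inter> X"]) blast
    qed
  qed
  then show ?thesis
    by (simp add: strong_measure_zero_def)
qed

lemma strong_measure_zeroE:
  fixes \<epsilon> :: "nat \<Rightarrow> real"
  assumes "strong_measure_zero m X" "\<And>n. 0 < \<epsilon> n"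
  obtains U :: "nat \<Rightarrow> 'a set" where "\<And>n. diam_le m (\<epsilon> n) (U n)" "\<And>x. x \<in> X \<Longrightarrow> \<exists>n. x \<in> U n"
proof -
  have "\<forall>n. 0 < \<epsilon> n" using assms(2) by blast
  then obtain U :: "nat \<Rightarrow> 'a set" where U: "\<forall>n. diam_le m (\<epsilon> n) (U n)" "X \<subseteq> (\<Union>n. U n)"
    using assms(1)[unfolded strong_measure_zero_iff, THEN conjunct2, rule_format, of \<epsilon>] by blast
  show thesis
  proof (rule that)
    show "diam_le m (\<epsilon> n) (U n)" for n using U(1) by blast
    show "\<exists>n. x \<in> U n" if "x \<in> X" for x using U(2) that by blast
  qed
qed

text \<open>
  Zindulka's sharp measure zero, in the form of covers whose index set splits into the
  blocks \<open>{b i..<b (Suc i)}\<close>. A point has to be caught in almost every block; the indices below \<open>b 0\<close>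
  belong to no block.
\<close>

definition sharp_measure_zero :: "'a metric \<Rightarrow> 'a set \<Rightarrow> bool" where
  "sharp_measure_zero m X \<longleftrightarrow>
     X \<subseteq> mspace m \<and>
     (\<forall>\<epsilon>. (\<forall>n. 0 < \<epsilon> n) \<longrightarrow>
        (\<exists>(U :: nat \<Rightarrow> 'a set) b. strict_mono b \<and> (\<forall>n. diam_le m (\<epsilon> n) (U n) \<and> U n \<subseteq> X) \<and>
          (\<forall>x\<in>X. \<forall>\<^sub>F i in sequentially. \<exists>n\<in>{b i..<b (Suc i)}. x \<in> U n)))"

lemma sharp_measure_zeroE:
  fixes \<epsilon> :: "nat \<Rightarrow> real"
  assumes "sharp_measure_zero m X" "\<And>n. 0 < \<epsilon> n"
  obtains U b where "strict_mono b" "\<And>n. diam_le m (\<epsilon> n) (U n)" "\<And>n. U n \<subseteq> X"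
    "\<And>x. x \<in> X \<Longrightarrow> \<forall>\<^sub>F i in sequentially. \<exists>n\<in>{b i..<b (Suc i)}. x \<in> U n"
proof -
  have "\<forall>n. 0 < \<epsilon> n" using assms(2) by blast
  then obtain U b where *: "strict_mono b \<and> (\<forall>n. diam_le m (\<epsilon> n) (U n) \<and> U n \<subseteq> X) \<and>
          (\<forall>x\<in>X. \<forall>\<^sub>F i in sequentially. \<exists>n\<in>{b i..<b (Suc i)}. x \<in> U n)"
    using assms(1)[unfolded sharp_measure_zero_def, THEN conjunct2, rule_format, of \<epsilon>] by blast
  show thesis
  proof (rule that)
    show "strict_mono b" using * by blast
    show "diam_le m (\<epsilon> n) (U n)" "U n \<subseteq> X" for n using * by blast+
    show "\<forall>\<^sub>F i in sequentially. \<exists>n\<in>{b i..<b (Suc i)}. x \<in> U n" if "x \<in> X" for x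
      using * that by blast
  qed
qed

lemma ex_positive_lower_bound:
  fixes \<epsilon> :: "nat \<Rightarrow> real"
  assumes "\<And>n. 0 < \<epsilon> n"
  shows "\<exists>\<eta>>0. \<forall>n<N. \<eta> \<le> \<epsilon> n"
proof (induction N)
  case 0
  show ?case by (intro exI[of _ 1]) auto
next
  case (Suc N)
  then obtain \<eta> where "\<eta> > 0" "\<forall>n<N. \<eta> \<le> \<epsilon> n" by blast
  then show ?case
    using assms[of N] by (intro exI[of _ "min \<eta> (\<epsilon> N)"]) (auto simp: less_Suc_eq min.coboundedI1)
qed

lemma block_unique:
  fixes b :: "nat \<Rightarrow> nat"
  assumes "strict_mono b" "b i \<le> n" "n < b (Suc i)" "b j \<le> n" "n < b (Suc j)"
  shows "i = (j::nat)"
proof (rule linorder_cases[of i j])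
  assume "i < j"
  then have "b (Suc i) \<le> b j"
    using strict_mono_less_eq[OF assms(1), of "Suc i" j] by simp
  with assms have False by linarith
  then show ?thesis ..
next
  assume "j < i"
  then have "b (Suc j) \<le> b i"
    using strict_mono_less_eq[OF assms(1), of "Suc j" i] by simp
  with assms have False by linarith
  then show ?thesis ..
qed

lemma in_block_compose:
  fixes b c :: "nat \<Rightarrow> nat"
  assumes "strict_mono b" "l \<in> {c i..<c (Suc i)}" "n \<in> {b l..<b (Suc l)}"
  shows "n \<in> {b (c i)..<b (c (Suc i))}"
proof -
  have "b (c i) \<le> b l" "b (Suc l) \<le> b (c (Suc i))"
    using assms(2) strict_mono_less_eq[OF assms(1)] by auto
  with assms(3) show ?thesis by auto
qed

text \<open>
  A way to build such covers when the number \<open>S k\<close> of sets available at level \<open>k\<close> becomes known only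
  during the construction: the levels are laid out one after the other, level \<open>k\<close> occupying the
  indices \<open>e k + a\<close> with \<open>a < S k\<close>, and \<open>b\<close> groups levels instead of indices.
\<close>

lemma sharp_measure_zero_from_levels:
  assumes X: "X \<subseteq> mspace m"
    and levels: "\<And>\<epsilon>::nat \<Rightarrow> real. (\<And>n. 0 < \<epsilon> n) \<Longrightarrow>
      \<exists>e b S V. strict_mono b \<and> (\<forall>k. 0 < S k \<and> e (Suc k) = e k + S k) \<and>
        (\<forall>k. \<forall>a<S k. diam_le m (\<epsilon> (e k + a)) (V k a)) \<and>
        (\<forall>x\<in>X. \<forall>\<^sub>F i in sequentially. \<exists>k\<in>{b i..<b (Suc i)}. \<exists>a<S k. x \<in> V k a)"
  shows "sharp_measure_zero m X"
  unfolding sharp_measure_zero_def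
proof (intro conjI X allI impI)
  fix \<epsilon> :: "nat \<Rightarrow> real" assume "\<forall>n. 0 < \<epsilon> n"
  then obtain e b S V where b: "strict_mono b" and e: "\<And>k. 0 < S k \<and> e (Suc k) = e k + S k"
    and V: "\<And>k a. a < S k \<Longrightarrow> diam_le m (\<epsilon> (e k + a)) (V k a)"
    and cov: "\<And>x. x \<in> X \<Longrightarrow> \<forall>\<^sub>F i in sequentially. \<exists>k\<in>{b i..<b (Suc i)}. \<exists>a<S k. x \<in> V k a"
    using levels[of \<epsilon>] by blast
  have smono: "strict_mono e"
    using e by (simp add: strict_mono_Suc_iff)
  define U where "U n = {x\<in>X. \<exists>k. \<exists>a<S k. n = e k + a \<and> x \<in> V k a}" for n
  have U: "U (e k + a) \<subseteq> V k a" if "a < S k" for k a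
  proof
    fix x assume "x \<in> U (e k + a)"
    then obtain k' a' where *: "a' < S k'" "e k + a = e k' + a'" "x \<in> V k' a'"
      unfolding U_def by blast
    then have "k = k'"
      using block_unique[OF smono, of k "e k + a" k'] e that by simp
    with * show "x \<in> V k a" by simp
  qed
  have "diam_le m (\<epsilon> n) (U n)" for n
  proof (cases "\<exists>k. \<exists>a<S k. n = e k + a")
    case True
    then show ?thesis using U V diam_le_subset by blast
  next
    case False
    then show ?thesis by (auto simp: U_def diam_le_def)
  qed
  moreover have "\<forall>\<^sub>F i in sequentially. \<exists>n\<in>{(e \<circ> b) i..<(e \<circ> b) (Suc i)}. x \<in> U n" if "x \<in> X" for x
    using cov[OF that]
  proof eventually_elim
    case (elim i)
    then obtain k a where "k \<in> {b i..<b (Suc i)}" "a < S k" "x \<in> V k a" by blast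
    then show ?case
      using in_block_compose[OF smono, of k b i "e k + a"] that e
      by (intro bexI[of _ "e k + a"]) (auto simp: U_def)
  qed
  moreover have "strict_mono (e \<circ> b)"
    using smono b by (rule strict_mono_o)
  ultimately show "\<exists>U b. strict_mono b \<and> (\<forall>n. diam_le m (\<epsilon> n) (U n) \<and> U n \<subseteq> X) \<and>
          (\<forall>x\<in>X. \<forall>\<^sub>F i in sequentially. \<exists>n\<in>{b i..<b (Suc i)}. x \<in> U n)"
    by (intro exI[of _ U] exI[of _ "e \<circ> b"]) (simp add: U_def)
qed

text \<open>
  Level \<open>k\<close> lists the first \<open>k + 1\<close> points, so that each point occurs in all levels from some one on.
\<close>

lemma countable_imp_sharp_measure_zero:
  assumes X: "X \<subseteq> mspace m" and "countable X"
  shows "sharp_measure_zero m X"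
proof (rule sharp_measure_zero_from_levels[OF X])
  fix \<epsilon> :: "nat \<Rightarrow> real" assume \<epsilon>: "\<And>n. 0 < \<epsilon> n"
  define e :: "nat \<Rightarrow> nat" where "e k = (\<Sum>i<k. Suc i)" for k
  define V where "V k a = {x \<in> X. to_nat_on X x = a}" for k a :: nat
  have single: "x = y" if "x \<in> V k a" "y \<in> V k a" for x y k a
    using that inj_on_eq_iff[OF inj_on_to_nat_on[OF assms(2)]] by (auto simp: V_def)
  have "diam_le m r (V k a)" if "0 < r" for r k a
    unfolding diam_le_def
  proof (intro ballI)
    fix x y assume "x \<in> V k a" "y \<in> V k a"
    then have "x = y" "x \<in> mspace m"
      using single X by (auto simp: V_def)
    then show "mdist m x y \<le> r" using that by (metis mdist_zero less_imp_le)
  qed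
  moreover have "\<forall>\<^sub>F i in sequentially. \<exists>k\<in>{id i..<id (Suc i)}. \<exists>a<Suc k. x \<in> V k a" if "x \<in> X" for x
    using eventually_ge_at_top[of "to_nat_on X x"]
    by eventually_elim (use that in \<open>auto simp: V_def\<close>)
  moreover have "strict_mono (id::nat\<Rightarrow>nat)" by (simp add: strict_mono_def)
  ultimately show "\<exists>e b S V. strict_mono b \<and> (\<forall>k. 0 < S k \<and> e (Suc k) = e k + S k) \<and>
        (\<forall>k. \<forall>a<S k. diam_le m (\<epsilon> (e k + a)) (V k a)) \<and>
        (\<forall>x\<in>X. \<forall>\<^sub>F i in sequentially. \<exists>k\<in>{b i..<b (Suc i)}. \<exists>a<S k. x \<in> V k a)"
    using \<epsilon> by (intro exI[of _ e] exI[of _ id] exI[of _ Suc] exI[of _ V]) (auto simp: e_def)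
qed

section \<open>Products\<close>

lemma diam_le_Times:
  assumes "diam_le m1 r U" "diam_le m2 s V" "r + s \<le> t"
  shows "diam_le (prod_metric m1 m2) t (U \<times> V)"
proof -
  have "prod_dist (mdist m1) (mdist m2) (x,y) (x',y') \<le> t"
    if "x \<in> U" "y \<in> V" "x' \<in> U" "y' \<in> V" for x y x' y'
  proof -
    have "prod_dist (mdist m1) (mdist m2) (x,y) (x',y') \<le> mdist m1 x x' + mdist m2 y y'"
      by (simp add: prod_dist_def sqrt_sum_squares_le_sum)
    also have "\<dots> \<le> t"
      using diam_leD[OF assms(1) that(1,3)] diam_leD[OF assms(2) that(2,4)] assms(3) by linarith
    finally show ?thesis .
  qed
  then show ?thesis by (auto simp: diam_le_def)
qed

lemma ex_halves_below:
  fixes \<epsilon> :: "nat \<Rightarrow> real" and f :: "nat \<Rightarrow> nat"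
  assumes "\<And>n. 0 < \<epsilon> n"
  obtains \<eta> where "\<And>l. 0 < \<eta> l" "\<And>l n. n < f l \<Longrightarrow> \<eta> l \<le> \<epsilon> n / 2"
proof -
  have "\<exists>\<eta>>0. \<forall>n<N. \<eta> \<le> \<epsilon> n / 2" for N
    by (rule ex_positive_lower_bound) (simp add: assms)
  then obtain g where "\<And>N. 0 < g N \<and> (\<forall>n<N. g N \<le> \<epsilon> n / 2)"
    by metis
  then show thesis
    by (intro that[of "\<lambda>l. g (f l)"]) auto
qed

text \<open>
  The second cover is indexed by the blocks of the first: \<open>V l\<close> is as small as all \<open>\<epsilon> n\<close> with \<open>n\<close> in
  block \<open>l\<close> require, and it is multiplied with exactly the \<open>U n\<close> of that block. A block of \<open>V\<close> then
  turns into a union of blocks of \<open>U\<close>.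
\<close>

lemma sharp_measure_zero_Times:
  assumes X: "sharp_measure_zero m1 X" and Y: "sharp_measure_zero m2 Y"
  shows "sharp_measure_zero (prod_metric m1 m2) (X \<times> Y)"
  unfolding sharp_measure_zero_def
proof (intro conjI allI impI)
  show "X \<times> Y \<subseteq> mspace (prod_metric m1 m2)"
    using X Y unfolding sharp_measure_zero_def by auto
  fix \<epsilon> :: "nat \<Rightarrow> real" assume \<epsilon>: "\<forall>n. 0 < \<epsilon> n"
  obtain U b where b: "strict_mono b" and U: "\<And>n. diam_le m1 (\<epsilon> n / 2) (U n)" "\<And>n. U n \<subseteq> X"
    and covX: "\<And>x. x \<in> X \<Longrightarrow> \<forall>\<^sub>F i in sequentially. \<exists>n\<in>{b i..<b (Suc i)}. x \<in> U n"
  proof (rule sharp_measure_zeroE[OF X, of "\<lambda>n. \<epsilon> n / 2"])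
    show "0 < \<epsilon> n / 2" for n using \<epsilon> by simp
  qed blast
  obtain \<eta> where \<eta>: "\<And>l. 0 < \<eta> l" "\<And>l n. n < b (Suc l) \<Longrightarrow> \<eta> l \<le> \<epsilon> n / 2"
    using ex_halves_below[of \<epsilon> "\<lambda>l. b (Suc l)"] \<epsilon> by blast
  obtain V c where c: "strict_mono c" and V: "\<And>l. diam_le m2 (\<eta> l) (V l)" "\<And>l. V l \<subseteq> Y"
    and covY: "\<And>y. y \<in> Y \<Longrightarrow> \<forall>\<^sub>F i in sequentially. \<exists>l\<in>{c i..<c (Suc i)}. y \<in> V l"
    by (rule sharp_measure_zeroE[OF Y, of \<eta>]) (use \<eta>(1) in blast)+
  \<comment> \<open>The union has one member, the block of \<open>n\<close>, and is empty for \<open>n < b 0\<close>.\<close>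
  define W where "W n = (\<Union>l\<in>{l. n \<in> {b l..<b (Suc l)}}. U n \<times> V l)" for n
  have W: "W n \<subseteq> U n \<times> V l" if "n \<in> {b l..<b (Suc l)}" for n l
    using block_unique[OF b, of l n] that by (auto simp: W_def)
  have "diam_le (prod_metric m1 m2) (\<epsilon> n) (W n)" for n
  proof (cases "\<exists>l. n \<in> {b l..<b (Suc l)}")
    case True
    then obtain l where l: "n \<in> {b l..<b (Suc l)}" by blast
    have "diam_le (prod_metric m1 m2) (\<epsilon> n) (U n \<times> V l)"
      using diam_le_Times[OF U(1) V(1), of n l "\<epsilon> n"] \<eta>(2)[of n l] l by auto
    then show ?thesis
      using W[OF l] diam_le_subset by blast
  next
    case False
    then show ?thesis by (auto simp: W_def diam_le_def)
  qed
  moreover have "W n \<subseteq> X \<times> Y" for n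
    using U(2) V(2) unfolding W_def by blast
  moreover have "\<forall>\<^sub>F i in sequentially. \<exists>n\<in>{(b \<circ> c) i..<(b \<circ> c) (Suc i)}. p \<in> W n"
    if "p \<in> X \<times> Y" for p
  proof -
    obtain x y where p: "p = (x, y)" and x: "x \<in> X" and y: "y \<in> Y"
      using \<open>p \<in> X \<times> Y\<close> by blast
    obtain i0 where i0: "\<And>l. l \<ge> i0 \<Longrightarrow> \<exists>n\<in>{b l..<b (Suc l)}. x \<in> U n"
      using covX[OF x] unfolding eventually_sequentially by blast
    show ?thesis
      using covY[OF y] eventually_ge_at_top[of i0]
    proof eventually_elim
      case (elim i)
      then obtain l where l: "l \<in> {c i..<c (Suc i)}" "y \<in> V l" by blast
      moreover have "i \<le> c i"
        using c by (rule strict_mono_imp_increasing)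
      ultimately obtain n where n: "n \<in> {b l..<b (Suc l)}" "x \<in> U n"
        using i0[of l] elim by auto
      then show ?case
        using in_block_compose[OF b l(1) n(1)] l p
        by (intro bexI[of _ n]) (auto simp: W_def)
    qed
  qed
  ultimately show "\<exists>U b'. strict_mono b' \<and>
      (\<forall>n. diam_le (prod_metric m1 m2) (\<epsilon> n) (U n) \<and> U n \<subseteq> X \<times> Y) \<and>
      (\<forall>x\<in>X \<times> Y. \<forall>\<^sub>F i in sequentially. \<exists>n\<in>{b' i..<b' (Suc i)}. x \<in> U n)"
    using strict_mono_o[OF b c] by (intro exI[of _ W] exI[of _ "b \<circ> c"]) simp
qed

text \<open>
  Countably many covers, for the subsequences \<open>\<epsilon> (prod_encode (t, n))\<close>, are interleaved into one. Every
  point is caught by each of them.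
\<close>

lemma strong_measure_zero_infinitely_often:
  assumes X: "strong_measure_zero m X" and \<epsilon>: "\<And>n. 0 < \<epsilon> n"
  obtains U :: "nat \<Rightarrow> 'a set" where "\<And>n. diam_le m (\<epsilon> n) (U n)"
    "\<And>x. x \<in> X \<Longrightarrow> \<exists>\<^sub>F n in sequentially. x \<in> U n"
proof -
  have "\<exists>U :: nat \<Rightarrow> 'a set. (\<forall>n. diam_le m (\<epsilon> (prod_encode (t, n))) (U n)) \<and> (\<forall>x\<in>X. \<exists>n. x \<in> U n)" for t
    by (rule strong_measure_zeroE[OF X, of "\<lambda>n. \<epsilon> (prod_encode (t, n))"]) (use \<epsilon> in blast)+
  then obtain U :: "nat \<Rightarrow> nat \<Rightarrow> 'a set" where U: "\<And>t n. diam_le m (\<epsilon> (prod_encode (t, n))) (U t n)"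
    "\<And>t x. x \<in> X \<Longrightarrow> \<exists>n. x \<in> U t n"
    by metis
  define V where "V n = (case prod_decode n of (t, j) \<Rightarrow> U t j)" for n
  have "diam_le m (\<epsilon> n) (V n)" for n
    using U(1)[of "fst (prod_decode n)" "snd (prod_decode n)"] by (simp add: V_def split_beta)
  moreover have "\<exists>\<^sub>F n in sequentially. x \<in> V n" if "x \<in> X" for x
    unfolding frequently_sequentially
  proof
    fix N
    obtain j where "x \<in> U N j" using U(2)[OF \<open>x \<in> X\<close>] by blast
    then show "\<exists>n\<ge>N. x \<in> V n"
      by (intro exI[of _ "prod_encode (N, j)"]) (auto simp: V_def le_prod_encode_1)
  qed
  ultimately show thesis using that by blast
qed

text \<open>
  Now the blocks belong to the second factor. The first point is caught for infinitely many block
  numbers \<open>l\<close>, the second point in almost every block, so some \<open>l\<close> serves both.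
\<close>

lemma strong_measure_zero_Times_sharp:
  assumes X: "strong_measure_zero m1 X" and Y: "sharp_measure_zero m2 Y"
  shows "strong_measure_zero (prod_metric m1 m2) (X \<times> Y)"
  unfolding strong_measure_zero_iff
proof (intro conjI allI impI)
  show "X \<times> Y \<subseteq> mspace (prod_metric m1 m2)"
    using X Y unfolding sharp_measure_zero_def strong_measure_zero_def by auto
  fix \<epsilon> :: "nat \<Rightarrow> real" assume \<epsilon>: "\<forall>n. 0 < \<epsilon> n"
  obtain V b where b: "strict_mono b" and V: "\<And>n. diam_le m2 (\<epsilon> n / 2) (V n)"
    and covY: "\<And>y. y \<in> Y \<Longrightarrow> \<forall>\<^sub>F i in sequentially. \<exists>n\<in>{b i..<b (Suc i)}. y \<in> V n"
  proof (rule sharp_measure_zeroE[OF Y, of "\<lambda>n. \<epsilon> n / 2"])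
    show "0 < \<epsilon> n / 2" for n using \<epsilon> by simp
  qed blast
  obtain \<eta> where \<eta>: "\<And>l. 0 < \<eta> l" "\<And>l n. n < b (Suc l) \<Longrightarrow> \<eta> l \<le> \<epsilon> n / 2"
    using ex_halves_below[of \<epsilon> "\<lambda>l. b (Suc l)"] \<epsilon> by blast
  obtain U where U: "\<And>l. diam_le m1 (\<eta> l) (U l)"
    and covX: "\<And>x. x \<in> X \<Longrightarrow> \<exists>\<^sub>F l in sequentially. x \<in> U l"
    by (rule strong_measure_zero_infinitely_often[OF X, of \<eta>]) (use \<eta>(1) in blast)+
  define W where "W n = (\<Union>l\<in>{l. n \<in> {b l..<b (Suc l)}}. U l \<times> V n)" for n
  have W: "W n \<subseteq> U l \<times> V n" if "n \<in> {b l..<b (Suc l)}" for n l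
    using block_unique[OF b, of l n] that by (auto simp: W_def)
  have "diam_le (prod_metric m1 m2) (\<epsilon> n) (W n)" for n
  proof (cases "\<exists>l. n \<in> {b l..<b (Suc l)}")
    case True
    then obtain l where l: "n \<in> {b l..<b (Suc l)}" by blast
    have "diam_le (prod_metric m1 m2) (\<epsilon> n) (U l \<times> V n)"
      using diam_le_Times[OF U V, of l n "\<epsilon> n"] \<eta>(2)[of n l] l by auto
    then show ?thesis
      using W[OF l] diam_le_subset by blast
  next
    case False
    then show ?thesis by (auto simp: W_def diam_le_def)
  qed
  moreover have "\<exists>n. (x, y) \<in> W n" if "x \<in> X" "y \<in> Y" for x y
  proof -
    obtain l where "x \<in> U l" "\<exists>n\<in>{b l..<b (Suc l)}. y \<in> V n"
      using frequently_ex[OF frequently_eventually_conj[OF covX[OF \<open>x \<in> X\<close>] covY[OF \<open>y \<in> Y\<close>]]] by blast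
    then show ?thesis unfolding W_def by blast
  qed
  ultimately show "\<exists>U. (\<forall>n. diam_le (prod_metric m1 m2) (\<epsilon> n) (U n)) \<and> X \<times> Y \<subseteq> (\<Union>n. U n)"
    by (intro exI[of _ W]) auto
qed

section \<open>Independence of the metric on sigma-compact spaces\<close>

definition sigma_compact :: "'a topology \<Rightarrow> bool" where
  "sigma_compact T \<longleftrightarrow> (\<exists>K :: nat \<Rightarrow> 'a set. (\<forall>n. compactin T (K n)) \<and> topspace T = (\<Union>n. K n))"

lemma sigma_compact_prod_topology:
  assumes "sigma_compact S" "sigma_compact T"
  shows "sigma_compact (prod_topology S T)"
proof -
  obtain K L :: "nat \<Rightarrow> _ set" where K: "\<And>n. compactin S (K n)" "topspace S = (\<Union>n. K n)"
    and L: "\<And>n. compactin T (L n)" "topspace T = (\<Union>n. L n)"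
    using assms unfolding sigma_compact_def by metis
  define P where "P n = (case prod_decode n of (i, j) \<Rightarrow> K i \<times> L j)" for n
  have "compactin (prod_topology S T) (P n)" for n
    using K L by (auto simp: P_def compactin_Times split: prod.split)
  moreover have "(x, y) \<in> (\<Union>n. P n)" if "x \<in> K i" "y \<in> L j" for x y i j
    using that by (auto simp: P_def intro!: exI[of _ "prod_encode (i, j)"])
  ultimately show ?thesis
    unfolding sigma_compact_def
  proof (intro exI[of _ P] conjI allI equalityI subsetI)
    fix p assume "p \<in> (\<Union>n. P n)"
    then show "p \<in> topspace (prod_topology S T)"
      using compactin_subset_topspace[OF \<open>compactin (prod_topology S T) (P _)\<close>] by blast
  next
    fix p assume "p \<in> topspace (prod_topology S T)"
    then obtain x y i j where "p = (x, y)" "x \<in> K i" "y \<in> L j"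
      using K(2) L(2) by auto
    then show "p \<in> (\<Union>n. P n)"
      using \<open>\<And>x y i j. x \<in> K i \<Longrightarrow> y \<in> L j \<Longrightarrow> (x, y) \<in> (\<Union>n. P n)\<close> by blast
  qed
qed

text \<open>
  The identity is uniformly continuous on \<open>K\<close> from one metric to the other.
\<close>

lemma uniform_modulus_on_compact:
  assumes eq: "mtopology_of m = mtopology_of m'" and K: "compactin (mtopology_of m) K" and "0 < \<epsilon>"
  shows "\<exists>\<delta>>0. \<forall>U. diam_le m \<delta> U \<longrightarrow> diam_le m' \<epsilon> (U \<inter> K)"
proof -
  have sub: "K \<subseteq> mspace m"
    using compactin_subset_topspace[OF K] by simp
  have "continuous_map (mtopology_of (submetric m K)) (mtopology_of m') id"
    by (simp add: mtopology_of_submetric eq continuous_map_from_subtopology)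
  moreover have "compact_space (mtopology_of (submetric m K))"
    using K by (simp add: mtopology_of_submetric compact_space_subtopology)
  ultimately have "uniformly_continuous_map (submetric m K) m' id"
    by (simp add: continuous_imp_uniformly_continuous_map)
  then obtain \<delta> where \<delta>: "\<delta> > 0" "\<And>x y. x \<in> K \<Longrightarrow> y \<in> K \<Longrightarrow> mdist m x y < \<delta> \<Longrightarrow> mdist m' x y < \<epsilon>"
    using \<open>0 < \<epsilon>\<close> sub unfolding uniformly_continuous_map_def by (auto simp: Int_absorb2 subset_iff)
  show ?thesis
  proof (intro exI[of _ "\<delta> / 2"] conjI allI impI)
    fix U assume "diam_le m (\<delta> / 2) U"
    then have "mdist m x y < \<delta>" if "x \<in> U" "y \<in> U" for x y
      using that diam_leD[of m "\<delta> / 2" U x y] \<delta>(1) by linarith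
    then show "diam_le m' \<epsilon> (U \<inter> K)"
      using \<delta>(2) by (auto simp: diam_le_def intro: less_imp_le)
  qed (use \<delta> in auto)
qed

text \<open>
  The modulus of uniform continuity depends on the compact set, so each compact piece gets its own
  cover, with its own infinite share of the indices.
\<close>

lemma strong_measure_zero_change_metric:
  assumes eq: "mtopology_of m = mtopology_of m'" and \<sigma>: "sigma_compact (mtopology_of m)"
    and X: "strong_measure_zero m X"
  shows "strong_measure_zero m' X"
  unfolding strong_measure_zero_iff
proof (intro conjI allI impI)
  have "mspace m = mspace m'"
    using eq by (metis topspace_mtopology_of)
  then show "X \<subseteq> mspace m'"
    using X by (simp add: strong_measure_zero_def)
  fix \<epsilon> :: "nat \<Rightarrow> real" assume \<epsilon>: "\<forall>n. 0 < \<epsilon> n"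
  obtain K :: "nat \<Rightarrow> 'a set" where K: "\<And>t. compactin (mtopology_of m) (K t)" "mspace m = (\<Union>t. K t)"
    using \<sigma> unfolding sigma_compact_def by auto
  have "\<exists>\<delta>>0. \<forall>U. diam_le m \<delta> U \<longrightarrow> diam_le m' (\<epsilon> n) (U \<inter> K t)" for n t
    using uniform_modulus_on_compact[OF eq K(1)] \<epsilon> by blast
  then obtain \<delta> where \<delta>: "\<And>n t. 0 < \<delta> n t"
    "\<And>n t U. diam_le m (\<delta> n t) U \<Longrightarrow> diam_le m' (\<epsilon> n) (U \<inter> K t)"
    by metis
  have "\<exists>U :: nat \<Rightarrow> 'a set. (\<forall>n. diam_le m (\<delta> (prod_encode (t, n)) t) (U n)) \<and> (\<forall>x\<in>X. \<exists>n. x \<in> U n)" for t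
    by (rule strong_measure_zeroE[OF X, of "\<lambda>n. \<delta> (prod_encode (t, n)) t"]) (use \<delta>(1) in blast)+
  then obtain U :: "nat \<Rightarrow> nat \<Rightarrow> 'a set"
    where U: "\<And>t n. diam_le m (\<delta> (prod_encode (t, n)) t) (U t n)" "\<And>t x. x \<in> X \<Longrightarrow> \<exists>n. x \<in> U t n"
    by metis
  define V where "V n = (case prod_decode n of (t, j) \<Rightarrow> U t j \<inter> K t)" for n
  have "diam_le m' (\<epsilon> n) (V n)" for n
    using \<delta>(2)[OF U(1)[of "fst (prod_decode n)" "snd (prod_decode n)"]]
    by (simp add: V_def split_beta)
  moreover have "\<exists>n. x \<in> V n" if "x \<in> X" for x
  proof -
    obtain t where "x \<in> K t"
      using \<open>x \<in> X\<close> \<open>X \<subseteq> mspace m'\<close> \<open>mspace m = mspace m'\<close> K(2) by blast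
    moreover obtain j where "x \<in> U t j"
      using U(2)[OF \<open>x \<in> X\<close>] by blast
    ultimately show ?thesis
      by (intro exI[of _ "prod_encode (t, j)"]) (simp add: V_def)
  qed
  ultimately show "\<exists>U. (\<forall>n. diam_le m' (\<epsilon> n) (U n)) \<and> X \<subseteq> (\<Union>n. U n)"
    by (intro exI[of _ V]) auto
qed

section \<open>Nowhere dense and meager sets\<close>

lemma nowhere_dense_in_subset:
  assumes "nowhere_dense_in T S" "A \<subseteq> S"
  shows "nowhere_dense_in T A"
proof -
  have "T interior_of (T closure_of A) \<subseteq> T interior_of (T closure_of S)"
    using assms(2) by (intro interior_of_mono closure_of_mono)
  with assms show ?thesis
    unfolding nowhere_dense_in_def by blast
qed

lemma nowhere_dense_in_Un:
  assumes "nowhere_dense_in T S" "nowhere_dense_in T S'"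
  shows "nowhere_dense_in T (S \<union> S')"
  using assms unfolding nowhere_dense_in_def
  by (simp add: closure_of_Un interior_of_union_eq_empty)

lemma nowhere_dense_in_UN:
  assumes "finite I" "\<And>i. i \<in> I \<Longrightarrow> nowhere_dense_in T (S i)"
  shows "nowhere_dense_in T (\<Union>i\<in>I. S i)"
  using assms
proof (induction I)
  case empty
  show ?case by (simp add: nowhere_dense_in_def)
next
  case (insert i I)
  then show ?case by (simp add: nowhere_dense_in_Un)
qed

lemma nowhere_dense_in_closure_of:
  "nowhere_dense_in T S \<Longrightarrow> nowhere_dense_in T (T closure_of S)"
  by (simp add: nowhere_dense_in_def closure_of_subset_topspace)

lemma meager_in_subset:
  assumes "meager_in T S" "A \<subseteq> S"
  shows "meager_in T A"
proof -
  obtain N :: "nat \<Rightarrow> 'a set" where N: "\<And>n. nowhere_dense_in T (N n)" "S = (\<Union>n. N n)"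
    using assms(1) unfolding meager_in_def by blast
  have "nowhere_dense_in T (N n \<inter> A)" for n
    using nowhere_dense_in_subset[OF N(1)] by blast
  moreover have "A = (\<Union>n. N n \<inter> A)"
    using N(2) assms(2) by blast
  ultimately show ?thesis
    unfolding meager_in_def by (intro exI[of _ "\<lambda>n. N n \<inter> A"]) blast
qed

lemma nowhere_dense_imp_meager_in:
  assumes "nowhere_dense_in T S"
  shows "meager_in T S"
  unfolding meager_in_def using assms by (intro exI[of _ "\<lambda>_. S"]) auto

lemma meager_in_exhaustion:
  assumes "meager_in T S"
  obtains F :: "nat \<Rightarrow> 'a set" where "\<And>n. closedin T (F n)" "\<And>n. nowhere_dense_in T (F n)"
    "incseq F" "S \<subseteq> (\<Union>n. F n)"
proof -
  obtain N :: "nat \<Rightarrow> 'a set" where N: "\<And>n. nowhere_dense_in T (N n)" "S = (\<Union>n. N n)"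
    using assms unfolding meager_in_def by blast
  have cl: "N n \<subseteq> T closure_of (N n)" for n
    using N(1) by (intro closure_of_subset) (auto simp: nowhere_dense_in_def)
  show thesis
  proof (rule that)
    show "closedin T (\<Union>i\<le>n. T closure_of (N i))" for n
      by (intro closedin_Union) auto
    show "nowhere_dense_in T (\<Union>i\<le>n. T closure_of (N i))" for n
      using N(1) by (intro nowhere_dense_in_UN nowhere_dense_in_closure_of) auto
    show "incseq (\<lambda>n. \<Union>i\<le>n. T closure_of (N i))"
      by (intro monoI UN_mono) auto
    show "S \<subseteq> (\<Union>n. \<Union>i\<le>n. T closure_of (N i))"
      using N(2) cl by fastforce
  qed
qed

lemma meager_in_compact_exhaustion:
  assumes "meager_in T S" and "sigma_compact T"
  obtains P :: "nat \<Rightarrow> 'a set" where "\<And>n. compactin T (P n)" "\<And>n. nowhere_dense_in T (P n)"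
    "incseq P" "S \<subseteq> (\<Union>n. P n)"
proof -
  obtain F :: "nat \<Rightarrow> 'a set" where F: "\<And>n. closedin T (F n)" "\<And>n. nowhere_dense_in T (F n)"
    "incseq F" "S \<subseteq> (\<Union>n. F n)"
    using meager_in_exhaustion[OF assms(1)] by blast
  obtain K :: "nat \<Rightarrow> 'a set" where K: "\<And>n. compactin T (K n)" "topspace T = (\<Union>n. K n)"
    using assms(2) unfolding sigma_compact_def by blast
  show thesis
  proof (rule that)
    show "compactin T (F n \<inter> (\<Union>i\<le>n. K i))" for n
      using F(1) K(1) by (intro closed_Int_compactin compactin_Union) auto
    show "nowhere_dense_in T (F n \<inter> (\<Union>i\<le>n. K i))" for n
      using nowhere_dense_in_subset[OF F(2)] by blast
    show "incseq (\<lambda>n. F n \<inter> (\<Union>i\<le>n. K i))"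
      using F(3) by (intro monoI Int_mono UN_mono) (auto simp: incseqD)
    show "S \<subseteq> (\<Union>n. F n \<inter> (\<Union>i\<le>n. K i))"
    proof
      fix x assume "x \<in> S"
      then obtain n where n: "x \<in> F n" using F(4) by blast
      then have "x \<in> topspace T" using closedin_subset[OF F(1)] by blast
      then obtain i where "x \<in> K i" using K(2) by blast
      moreover have "x \<in> F (max n i)" using n incseqD[OF F(3), of n "max n i"] by auto
      ultimately show "x \<in> (\<Union>n. F n \<inter> (\<Union>i\<le>n. K i))" by (intro UN_I[of "max n i"]) auto
    qed
  qed
qed

context Metric_space
begin

lemma nowhere_dense_in_iff_ball:
  "nowhere_dense_in mtopology S \<longleftrightarrow> S \<subseteq> M \<and>
     (\<forall>c\<in>M. \<forall>r>0. \<exists>c'\<in>M. \<exists>r'>0. d c c' + r' \<le> r \<and> mcball c' r' \<inter> S = {})"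
proof (intro iffI conjI ballI allI impI)
  assume nd: "nowhere_dense_in mtopology S"
  show "S \<subseteq> M" using nd by (simp add: nowhere_dense_in_def)
  fix c and r :: real assume c: "c \<in> M" "r > 0"
  have "\<not> mball c r \<subseteq> mtopology closure_of S"
    using nd c unfolding nowhere_dense_in_def metric_interior_of by blast
  then obtain y where "y \<in> mball c r" and y: "y \<notin> mtopology closure_of S"
    by blast
  then have y: "y \<in> M" "d c y < r" "y \<notin> mtopology closure_of S"
    by auto
  then obtain s where s: "s > 0" "mball y s \<inter> S = {}"
    unfolding metric_closure_of by blast
  define r' where "r' = min (s / 2) (r - d c y)"
  have "mcball y r' \<subseteq> mball y s"
    using s(1) by (intro mcball_subset_mball_concentric) (auto simp: r'_def)
  then show "\<exists>c'\<in>M. \<exists>r'>0. d c c' + r' \<le> r \<and> mcball c' r' \<inter> S = {}"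
    using s y by (intro bexI[of _ y] exI[of _ r']) (auto simp: r'_def)
next
  assume *: "S \<subseteq> M \<and>
     (\<forall>c\<in>M. \<forall>r>0. \<exists>c'\<in>M. \<exists>r'>0. d c c' + r' \<le> r \<and> mcball c' r' \<inter> S = {})"
  have False if x: "x \<in> mtopology interior_of (mtopology closure_of S)" for x
  proof -
    obtain r where r: "r > 0" "x \<in> M" "mball x r \<subseteq> mtopology closure_of S"
      using x unfolding metric_interior_of by blast
    then obtain c' r' where c': "c' \<in> M" "r' > 0" "d x c' + r' \<le> r" "mcball c' r' \<inter> S = {}"
      using * by blast
    then have "c' \<in> mtopology closure_of S"
      using r by (auto simp: subset_iff)
    then have "\<exists>y\<in>S. y \<in> mcball c' r'"
      using c'(2) unfolding metric_closure_of_alt by blast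
    with c'(4) show False by blast
  qed
  with * show "nowhere_dense_in mtopology S"
    unfolding nowhere_dense_in_def by auto
qed

text \<open>
  For a compact nowhere dense set the gap inside a ball of radius \<open>\<rho>\<close> can be found with a size that does
  not depend on the centre: near \<open>P\<close> a gap next to one of finitely many points of \<open>P\<close> is available, and
  away from \<open>P\<close> the centre itself will do.
\<close>

lemma compact_nowhere_dense_uniformly_avoidable:
  assumes P: "compactin mtopology P" "nowhere_dense_in mtopology P" and "0 < \<rho>"
  shows "\<exists>\<eta>>0. \<forall>c\<in>M. \<exists>c'\<in>M. d c c' + \<eta> \<le> \<rho> \<and> (\<forall>p\<in>P. \<eta> \<le> d c' p)"
proof -
  obtain K where K: "finite K" "K \<subseteq> P" "P \<subseteq> (\<Union>x\<in>K. mball x (\<rho>/4))"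
    using compactin_imp_mtotally_bounded[OF P(1)] \<open>0 < \<rho>\<close>
    unfolding mtotally_bounded_def by (elim allE[of _ "\<rho>/4"]) auto
  have PM: "P \<subseteq> M" using P(2) by (simp add: nowhere_dense_in_def)
  have "\<exists>c s. x \<in> K \<longrightarrow> c \<in> M \<and> s > 0 \<and> d x c + s \<le> \<rho>/4 \<and> mcball c s \<inter> P = {}" for x
  proof (cases "x \<in> K")
    case True
    then have "x \<in> M" using K(2) PM by blast
    then have "\<exists>c'\<in>M. \<exists>r'>0. d x c' + r' \<le> \<rho>/4 \<and> mcball c' r' \<inter> P = {}"
      using P(2)[unfolded nowhere_dense_in_iff_ball, THEN conjunct2, rule_format, of x "\<rho>/4"] \<open>0 < \<rho>\<close>
      by simp
    then show ?thesis by blast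
  qed blast
  then obtain c s where cs: "\<And>x. x \<in> K \<Longrightarrow>
      c x \<in> M \<and> s x > 0 \<and> d x (c x) + s x \<le> \<rho>/4 \<and> mcball (c x) (s x) \<inter> P = {}"
    by metis
  define \<eta> where "\<eta> = Min (insert (\<rho>/4) (s ` K))"
  have \<eta>: "\<eta> > 0" "\<eta> \<le> \<rho>/4" "\<And>x. x \<in> K \<Longrightarrow> \<eta> \<le> s x"
  proof -
    have fin: "finite (insert (\<rho>/4) (s ` K))" using K(1) by simp
    show "\<eta> > 0"
      unfolding \<eta>_def using fin \<open>0 < \<rho>\<close> cs by (subst Min_gr_iff) auto
    show "\<eta> \<le> \<rho>/4" "\<And>x. x \<in> K \<Longrightarrow> \<eta> \<le> s x"
      unfolding \<eta>_def by (rule Min_le[OF fin]; simp)+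
  qed
  have "\<exists>c'\<in>M. d y c' + \<eta> \<le> \<rho> \<and> (\<forall>p\<in>P. \<eta> \<le> d c' p)" if y: "y \<in> M" for y
  proof (cases "\<forall>p\<in>P. \<rho>/4 \<le> d y p")
    case True
    then show ?thesis
      using y \<eta>(2) \<open>0 < \<rho>\<close> by (intro bexI[of _ y]) auto
  next
    case False
    then obtain p where p: "p \<in> P" "d y p < \<rho>/4" by auto
    then obtain x where x: "x \<in> K" "p \<in> mball x (\<rho>/4)" using K(3) by blast
    have M: "x \<in> M" "p \<in> M" "c x \<in> M" using x p PM cs by auto
    have "d y (c x) \<le> d y p + d x p + d x (c x)"
      using triangle[of y p "c x"] triangle[of p x "c x"] M y commute[of p x] by linarith
    moreover have "\<eta> \<le> d (c x) q" if "q \<in> P" for q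
    proof -
      have "q \<notin> mcball (c x) (s x)" "q \<in> M" using that cs[OF x(1)] PM by blast+
      then show ?thesis using \<eta>(3)[OF x(1)] M by auto
    qed
    ultimately show ?thesis
      using \<eta>(2) x p cs[OF x(1)] by (intro bexI[of _ "c x"]) auto
  qed
  with \<eta>(1) show ?thesis by blast
qed

end

section \<open>Sharp measure zero sets are meager-additive\<close>

locale invariant_metric_group = group G for G (structure) +
  fixes m :: "'a metric"
  assumes mspace_eq: "mspace m = carrier G"
    and mdist_left_mult: "\<lbrakk>x \<in> carrier G; y \<in> carrier G; z \<in> carrier G\<rbrakk>
      \<Longrightarrow> mdist m (z \<otimes> x) (z \<otimes> y) = mdist m x y"
    and mdist_right_mult: "\<lbrakk>x \<in> carrier G; y \<in> carrier G; z \<in> carrier G\<rbrakk>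
      \<Longrightarrow> mdist m (x \<otimes> z) (y \<otimes> z) = mdist m x y"
begin

abbreviation d where "d \<equiv> mdist m"

sublocale Metric_space "carrier G" "mdist m"
  using Metric_space_mspace_mdist[of m] by (simp add: mspace_eq)

lemma mtopology_of_eq: "mtopology_of m = mtopology"
  by (simp add: mtopology_of_def mspace_eq)

text \<open>
  A set \<open>U\<close> of small diameter is replaced by one of its points \<open>u\<close>: by left invariance \<open>P U\<close> stays close
  to \<open>P u\<close>. By right invariance gaps of \<open>P u\<close> are translates of gaps of \<open>P\<close>, whence the
  size of the gap depends neither on \<open>U\<close> nor on \<open>c\<close>.
\<close>

lemma translates_uniformly_avoidable:
  assumes P: "compactin mtopology P" "nowhere_dense_in mtopology P" and "0 < \<rho>"
  shows "\<exists>\<rho>'>0. \<rho>' \<le> \<rho> / 2 \<and> (\<forall>U\<subseteq>carrier G. diam_le m \<rho>' U \<longrightarrow>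
           (\<forall>c\<in>carrier G. \<exists>c'\<in>carrier G. d c c' + \<rho>' \<le> \<rho> \<and> mball c' \<rho>' \<inter> (P <#> U) = {}))"
proof -
  obtain \<eta> where \<eta>: "\<eta> > 0" and avoid: "\<And>c. c \<in> carrier G \<Longrightarrow>
      \<exists>c'\<in>carrier G. d c c' + \<eta> \<le> \<rho> \<and> (\<forall>p\<in>P. \<eta> \<le> d c' p)"
    using compact_nowhere_dense_uniformly_avoidable[OF P \<open>0 < \<rho>\<close>] by blast
  have PG: "P \<subseteq> carrier G" using P(2) by (simp add: nowhere_dense_in_def)
  have "\<eta> \<le> \<rho>" 
  proof -
    obtain c' where "d \<one> c' + \<eta> \<le> \<rho>" using avoid[OF one_closed] by blast
    then show ?thesis using mdist_nonneg[of m \<one> c'] by linarith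
  qed
  have "\<exists>c'\<in>carrier G. d c c' + \<eta>/2 \<le> \<rho> \<and> mball c' (\<eta>/2) \<inter> (P <#> U) = {}"
    if U: "U \<subseteq> carrier G" "diam_le m (\<eta>/2) U" and c: "c \<in> carrier G" for U c
  proof (cases "U = {}")
    case True
    have "P <#> U = {}" using True by (simp add: set_mult_def)
    then show ?thesis using c \<eta> \<open>\<eta> \<le> \<rho>\<close> by (intro bexI[of _ c]) auto
  next
    case False
    then obtain u where u: "u \<in> U" by blast
    then have uG: "u \<in> carrier G" using U by blast
    obtain c' where c': "c' \<in> carrier G" "d (c \<otimes> inv u) c' + \<eta> \<le> \<rho>" "\<And>p. p \<in> P \<Longrightarrow> \<eta> \<le> d c' p"
      using avoid[of "c \<otimes> inv u"] c uG by auto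
    have "d c (c' \<otimes> u) = d (c \<otimes> inv u) c'"
      using mdist_right_mult[of "c \<otimes> inv u" c' u] c c' uG by (simp add: m_assoc)
    moreover have "p \<otimes> v \<notin> mball (c' \<otimes> u) (\<eta>/2)" if p: "p \<in> P" and v: "v \<in> U" for p v
    proof
      assume "p \<otimes> v \<in> mball (c' \<otimes> u) (\<eta>/2)"
      moreover have G: "p \<in> carrier G" "v \<in> carrier G" using p v PG U by auto
      moreover have "d (p \<otimes> v) (p \<otimes> u) \<le> \<eta>/2"
        using mdist_left_mult[of v u p] G uG diam_leD[OF U(2) v u] by simp
      moreover have "d (c' \<otimes> u) (p \<otimes> u) = d c' p"
        using mdist_right_mult G c' uG by simp
      ultimately have "d c' p < \<eta>"
        using triangle[of "c' \<otimes> u" "p \<otimes> v" "p \<otimes> u"] c'(1) uG by simp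
      with c'(3)[OF p] show False by simp
    qed
    ultimately show ?thesis
      using c' uG \<eta> by (intro bexI[of _ "c' \<otimes> u"]) (auto simp: set_mult_def)
  qed
  then show ?thesis
    using \<eta> \<open>\<eta> \<le> \<rho>\<close> by (intro exI[of _ "\<eta>/2"]) auto
qed

theorem sharp_measure_zero_imp_meager_additive:
  assumes \<sigma>: "sigma_compact mtopology" and X: "sharp_measure_zero m X"
  shows "meager_additive G mtopology X"
  unfolding meager_additive_def
proof (intro conjI allI impI)
  show XG: "X \<subseteq> carrier G"
    using X by (simp add: sharp_measure_zero_def mspace_eq)
  fix A assume A: "meager_in mtopology A"
  obtain P :: "nat \<Rightarrow> 'a set" where P: "\<And>n. compactin mtopology (P n)"
    "\<And>n. nowhere_dense_in mtopology (P n)" "incseq P" "A \<subseteq> (\<Union>n. P n)"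
    using meager_in_compact_exhaustion[OF A \<sigma>] by blast
  have PG: "P n \<subseteq> carrier G" for n
    using P(2) by (simp add: nowhere_dense_in_def)
  define shrinks where "shrinks k r r' \<longleftrightarrow> r' \<le> r / 2 \<and> (\<forall>U\<subseteq>carrier G. diam_le m r' U \<longrightarrow>
       (\<forall>c\<in>carrier G. \<exists>c'\<in>carrier G. d c c' + r' \<le> r \<and> mball c' r' \<inter> (P k <#> U) = {}))" for k r r'
  have "\<exists>\<rho>. \<forall>k. (0 < \<rho> k \<and> \<rho> k \<le> (1/2)^k) \<and> shrinks k (\<rho> k) (\<rho> (Suc k))"
  proof (rule dependent_nat_choice)
    show "\<exists>x::real. 0 < x \<and> x \<le> (1/2)^0" by (intro exI[of _ 1]) auto
    fix x :: real and k assume x: "0 < x \<and> x \<le> (1/2)^k"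
    then obtain y where y: "0 < y" "shrinks k x y"
      using translates_uniformly_avoidable[OF P(1,2), of x k] unfolding shrinks_def by blast
    then have "y \<le> x / 2" by (simp add: shrinks_def)
    with x y show "\<exists>y. (0 < y \<and> y \<le> (1/2)^Suc k) \<and> shrinks k x y"
      by (intro exI[of _ y]) simp
  qed
  then obtain \<rho> where \<rho>: "\<And>k. 0 < \<rho> k" "\<And>k. \<rho> k \<le> (1/2)^k" "\<And>k. shrinks k (\<rho> k) (\<rho> (Suc k))"
    by auto
  have shrink: "\<lbrakk>U \<subseteq> carrier G; diam_le m (\<rho> (Suc k)) U; c \<in> carrier G\<rbrakk> \<Longrightarrow>
       \<exists>c'\<in>carrier G. d c c' + \<rho> (Suc k) \<le> \<rho> k \<and> mball c' (\<rho> (Suc k)) \<inter> (P k <#> U) = {}" for k U c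
    using \<rho>(3)[of k] unfolding shrinks_def by blast
  obtain U b where b: "strict_mono b" and U: "\<And>n. diam_le m (\<rho> (Suc n)) (U n)" "\<And>n. U n \<subseteq> X"
    and cov: "\<And>x. x \<in> X \<Longrightarrow> \<forall>\<^sub>F i in sequentially. \<exists>n\<in>{b i..<b (Suc i)}. x \<in> U n"
    by (rule sharp_measure_zeroE[OF X, of "\<lambda>n. \<rho> (Suc n)"]) (use \<rho>(1) in blast)+
  \<comment> \<open>\<open>B j\<close> collects the products for which both membership in \<open>P\<close> and the covering hold from \<open>j\<close> on.\<close>
  define B where "B j = P j <#> {x\<in>X. \<forall>i\<ge>j. \<exists>n\<in>{b i..<b (Suc i)}. x \<in> U n}" for j
  have "nowhere_dense_in mtopology (B j)" for j
    unfolding nowhere_dense_in_iff_ball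
  proof (intro conjI ballI allI impI)
    show "B j \<subseteq> carrier G"
      using PG XG by (auto simp: B_def set_mult_def)
    fix c and r :: real assume c: "c \<in> carrier G" and r: "0 < r"
    obtain N where N: "(1/2)^N < r"
      using real_arch_pow_inv[OF r, of "1/2"] by auto
    define i where "i = max N j"
    have bi: "i \<le> b i" using b by (rule strict_mono_imp_increasing)
    have "\<rho> (b i) \<le> (1/2)^b i" by (rule \<rho>)
    also have "\<dots> \<le> (1/2)^N"
      using bi by (intro power_decreasing) (auto simp: i_def)
    finally have \<rho>r: "\<rho> (b i) \<le> r" using N by simp
    \<comment> \<open>One shrinking step for each index of the block; the sets \<open>P k\<close> increase, so avoiding \<open>P k\<close> avoids \<open>P j\<close>.\<close>
    have chain: "\<exists>c'\<in>carrier G. d c c' + \<rho> k \<le> \<rho> (b i) \<and> (\<forall>n\<in>{b i..<k}. mball c' (\<rho> k) \<inter> (P j <#> U n) = {})"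
      if "b i \<le> k" for k
      using that
    proof (induction k rule: dec_induct)
      case base
      show ?case using c by (intro bexI[of _ c]) auto
    next
      case (step k)
      then obtain c' where c': "c' \<in> carrier G" "d c c' + \<rho> k \<le> \<rho> (b i)"
        "\<And>n. n \<in> {b i..<k} \<Longrightarrow> mball c' (\<rho> k) \<inter> (P j <#> U n) = {}"
        by blast
      obtain c'' where c'': "c'' \<in> carrier G" "d c' c'' + \<rho> (Suc k) \<le> \<rho> k"
        "mball c'' (\<rho> (Suc k)) \<inter> (P k <#> U k) = {}"
        using shrink[of "U k" k c'] U XG c'(1) by blast
      have sub: "mball c'' (\<rho> (Suc k)) \<subseteq> mball c' (\<rho> k)"
        using c'' c'(1) commute[of c' c''] by (intro mball_subset) auto
      have "P j <#> U k \<subseteq> P k <#> U k"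
        using bi step(1) incseqD[OF P(3), of j k] by (intro mono_set_mult) (auto simp: i_def)
      then have "mball c'' (\<rho> (Suc k)) \<inter> (P j <#> U n) = {}" if "n \<in> {b i..<Suc k}" for n
        using that c''(3) c'(3)[of n] sub by (cases "n = k") auto
      moreover have "d c c'' + \<rho> (Suc k) \<le> \<rho> (b i)"
        using triangle[of c c' c''] c c' c'' by linarith
      ultimately show ?case using c''(1) by blast
    qed
    have "b i \<le> b (Suc i)" using b by (simp add: strict_mono_less_eq)
    from chain[OF this] obtain c' where c': "c' \<in> carrier G" "d c c' + \<rho> (b (Suc i)) \<le> \<rho> (b i)"
      "\<And>n. n \<in> {b i..<b (Suc i)} \<Longrightarrow> mball c' (\<rho> (b (Suc i))) \<inter> (P j <#> U n) = {}"
      by blast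
    have "B j \<subseteq> (\<Union>n\<in>{b i..<b (Suc i)}. P j <#> U n)"
    proof
      fix y assume "y \<in> B j"
      then obtain p x where "p \<in> P j" "y = p \<otimes> x" "\<forall>i\<ge>j. \<exists>n\<in>{b i..<b (Suc i)}. x \<in> U n"
        unfolding B_def set_mult_def by blast
      moreover have "j \<le> i" by (simp add: i_def)
      ultimately show "y \<in> (\<Union>n\<in>{b i..<b (Suc i)}. P j <#> U n)"
        unfolding set_mult_def by blast
    qed
    moreover have "mcball c' (\<rho> (b (Suc i)) / 2) \<subseteq> mball c' (\<rho> (b (Suc i)))"
      using \<rho>(1) by (intro mcball_subset_mball_concentric) auto
    ultimately have "mcball c' (\<rho> (b (Suc i)) / 2) \<inter> B j = {}"
      using c'(3) by blast
    then show "\<exists>c'\<in>carrier G. \<exists>r'>0. d c c' + r' \<le> r \<and> mcball c' r' \<inter> B j = {}"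
      using c'(1,2) \<rho>r \<rho>(1)[of "b (Suc i)"]
      by (intro bexI[of _ c'] exI[of _ "\<rho> (b (Suc i)) / 2"]) auto
  qed
  then have "meager_in mtopology (\<Union>j. B j)"
    unfolding meager_in_def by blast
  moreover have "A <#> X \<subseteq> (\<Union>j. B j)"
  proof
    fix y assume "y \<in> A <#> X"
    then obtain a x where y: "y = a \<otimes> x" "a \<in> A" "x \<in> X"
      by (auto simp: set_mult_def)
    obtain j1 where j1: "a \<in> P j1" using P(4) y(2) by blast
    obtain j2 where j2: "\<And>i. i \<ge> j2 \<Longrightarrow> \<exists>n\<in>{b i..<b (Suc i)}. x \<in> U n"
      using cov[OF y(3)] unfolding eventually_sequentially by blast
    have "a \<in> P (max j1 j2)" using j1 incseqD[OF P(3), of j1 "max j1 j2"] by auto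
    then have "y \<in> B (max j1 j2)"
      using j2 y unfolding B_def set_mult_def by auto
    then show "y \<in> (\<Union>j. B j)" by blast
  qed
  ultimately show "meager_in mtopology (A <#> X)"
    by (rule meager_in_subset)
qed

end

section \<open>Topology of separable locally compact groups\<close>

lemma block_exists:
  fixes b :: "nat \<Rightarrow> nat"
  assumes "strict_mono b" "b 0 \<le> n"
  shows "\<exists>i. n \<in> {b i..<b (Suc i)}"
proof -
  have fin: "finite {i. b i \<le> n}"
  proof (rule finite_subset[of _ "{..n}"])
    show "{i. b i \<le> n} \<subseteq> {..n}"
    proof
      fix i assume "i \<in> {i. b i \<le> n}"
      then show "i \<in> {..n}"
        using strict_mono_imp_increasing[OF assms(1), of i] by simp
    qed
  qed simp
  define i where "i = Max {i. b i \<le> n}"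
  have "b i \<le> n"
    using Max_in[OF fin] assms(2) unfolding i_def by blast
  moreover have "\<not> b (Suc i) \<le> n"
    using Max_ge[OF fin, of "Suc i"] unfolding i_def by auto
  ultimately show ?thesis by (intro exI[of _ i]) auto
qed

context Metric_space
begin

lemma nested_mcballs_common_point:
  assumes K: "compactin mtopology (mcball a R)"
    and z: "\<And>i. z i \<in> M" and start: "d a (z 0) + \<rho> 0 \<le> R" "a \<in> M"
    and nested: "\<And>i. d (z i) (z (Suc i)) + \<rho> (Suc i) \<le> \<rho> i" and pos: "\<And>i. 0 \<le> \<rho> i"
  shows "\<exists>l\<in>M. \<forall>i. d (z i) l \<le> \<rho> i"
proof -
  have chain: "d (z i) (z j) + \<rho> j \<le> \<rho> i" if "i \<le> j" for i j
    using that
  proof (induction j rule: dec_induct)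
    case base
    show ?case using z by simp
  next
    case (step j)
    then show ?case
      using triangle[of "z i" "z j" "z (Suc j)"] z nested[of j] by fastforce
  qed
  have "d a (z j) \<le> R" for j
    using triangle[of a "z 0" "z j"] chain[of 0 j] start pos[of j] z by fastforce
  then have "range z \<subseteq> mcball a R"
    using z start by auto
  then obtain l s where l: "strict_mono s" "limitin mtopology (z \<circ> s) l sequentially"
    using K unfolding compactin_sequentially by blast
  have "l \<in> mcball (z i) (\<rho> i)" for i
  proof (rule limitin_closedin[OF l(2)])
    show "closedin mtopology (mcball (z i) (\<rho> i))" by blast
    have "(z \<circ> s) n \<in> mcball (z i) (\<rho> i)" if "n \<ge> i" for n
    proof -
      have "i \<le> s n" using that strict_mono_imp_increasing[OF l(1), of n] by simp
      from chain[OF this] show ?thesis using z pos[of "s n"] by auto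
    qed
    then show "\<forall>\<^sub>F n in sequentially. (z \<circ> s) n \<in> mcball (z i) (\<rho> i)"
      using eventually_sequentially by blast
  qed simp
  then show ?thesis by (intro bexI[of _ l]) auto
qed

lemma separable_space_dense_sequence:
  assumes "separable_space mtopology" "M \<noteq> {}"
  obtains p :: "nat \<Rightarrow> 'a" where "\<And>i. p i \<in> M" "\<And>x r. x \<in> M \<Longrightarrow> 0 < r \<Longrightarrow> \<exists>i. d (p i) x < r"
proof -
  obtain C where C: "countable C" "C \<subseteq> M" "mtopology closure_of C = M"
    using assms(1) unfolding separable_space_def by auto
  have "C \<noteq> {}" using C(3) assms(2) by auto
  show thesis
  proof (rule that[of "from_nat_into C"])
    show "from_nat_into C i \<in> M" for i
      using from_nat_into[OF \<open>C \<noteq> {}\<close>] C(2) by blast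
    fix x r assume x: "x \<in> M" and r: "(0::real) < r"
    then obtain y where y: "y \<in> C" "y \<in> mball x r"
      using C(3) unfolding metric_closure_of by blast
    then obtain i where "from_nat_into C i = y"
      using from_nat_into_surj[OF C(1)] by blast
    then show "\<exists>i. d (from_nat_into C i) x < r"
      using y by (intro exI[of _ i]) (simp add: commute)
  qed
qed

end

context invariant_metric_group
begin

lemma continuous_map_left_mult:
  assumes "g \<in> carrier G"
  shows "continuous_map mtopology mtopology (\<lambda>x. g \<otimes> x)"
proof -
  have "Lipschitz_continuous_map m m (\<lambda>x. g \<otimes> x)"
    unfolding Lipschitz_continuous_map_def
    using assms by (auto simp: mspace_eq mdist_left_mult intro!: exI[of _ 1])
  then show ?thesis
    using Lipschitz_continuous_imp_continuous_map[of m m] by (simp add: mtopology_of_eq)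
qed

lemma mcball_translate:
  assumes "g \<in> carrier G"
  shows "mcball g r = (\<lambda>x. g \<otimes> x) ` mcball \<one> r"
proof (intro equalityI subsetI)
  fix y assume y: "y \<in> mcball g r"
  then have "d \<one> (inv g \<otimes> y) = d g y"
    using mdist_left_mult[of g y "inv g"] assms by simp
  then show "y \<in> (\<lambda>x. g \<otimes> x) ` mcball \<one> r"
    using y assms by (intro image_eqI[of _ _ "inv g \<otimes> y"]) (auto simp: m_assoc[symmetric])
next
  fix y assume "y \<in> (\<lambda>x. g \<otimes> x) ` mcball \<one> r"
  then obtain x where "y = g \<otimes> x" "x \<in> carrier G" "d \<one> x \<le> r" by auto
  then show "y \<in> mcball g r"
    using mdist_left_mult[of \<one> x g] assms by simp
qed

text \<open>
  All balls of one fixed radius are compact, since they are translates of each other.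
\<close>

lemma compact_mcballs:
  assumes "locally_compact_space mtopology"
  obtains R where "0 < R" "\<And>g. g \<in> carrier G \<Longrightarrow> compactin mtopology (mcball g R)"
proof -
  obtain U K where UK: "openin mtopology U" "compactin mtopology K" "\<one> \<in> U" "U \<subseteq> K"
    using assms one_closed unfolding locally_compact_space_def topspace_mtopology by blast
  then obtain R where R: "R > 0" "mcball \<one> R \<subseteq> U"
    unfolding openin_mtopology_mcball by blast
  have "compactin mtopology (mcball \<one> R)"
    by (rule closed_compactin[OF UK(2)]) (use R UK in auto)
  then have "compactin mtopology (mcball g R)" if "g \<in> carrier G" for g
    unfolding mcball_translate[OF that]
    using continuous_map_left_mult[OF that] by (rule image_compactin)
  with R(1) show thesis by (rule that)
qed

lemma locally_compact_separable_imp_sigma_compact: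
  assumes "locally_compact_space mtopology" "separable_space mtopology"
  shows "sigma_compact mtopology"
proof -
  obtain R where R: "0 < R" "\<And>g. g \<in> carrier G \<Longrightarrow> compactin mtopology (mcball g R)"
    using compact_mcballs[OF assms(1)] by blast
  obtain p :: "nat \<Rightarrow> 'a" where p: "\<And>i. p i \<in> carrier G"
    "\<And>x r. x \<in> carrier G \<Longrightarrow> 0 < r \<Longrightarrow> \<exists>i. d (p i) x < r"
    using separable_space_dense_sequence[OF assms(2) carrier_not_empty] by blast
  have "carrier G \<subseteq> (\<Union>n. mcball (p n) R)"
  proof
    fix x assume x: "x \<in> carrier G"
    obtain i where "d (p i) x < R" using p(2)[OF x R(1)] by blast
    then have "x \<in> mcball (p i) R" using x p(1) by simp
    then show "x \<in> (\<Union>n. mcball (p n) R)" by blast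
  qed
  then show ?thesis
    unfolding sigma_compact_def using R(2)[OF p(1)]
    by (intro exI[of _ "\<lambda>n. mcball (p n) R"]) auto
qed

text \<open>
  A point within \<open>r\<close> of a member of a dense sequence coincides with it.
\<close>

lemma discrete_imp_countable:
  assumes "separable_space mtopology" "0 < r" "\<And>y. y \<in> carrier G \<Longrightarrow> d \<one> y < r \<Longrightarrow> y = \<one>"
  shows "countable (carrier G)"
proof -
  obtain p :: "nat \<Rightarrow> 'a" where p: "\<And>i. p i \<in> carrier G"
    "\<And>x r. x \<in> carrier G \<Longrightarrow> 0 < r \<Longrightarrow> \<exists>i. d (p i) x < r"
    using separable_space_dense_sequence[OF assms(1) carrier_not_empty] by blast
  have "x \<in> range p" if x: "x \<in> carrier G" for x
  proof -
    obtain i where i: "d (p i) x < r" using p(2)[OF x \<open>0 < r\<close>] by blast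
    have "d \<one> (inv (p i) \<otimes> x) = d (p i) x"
      using mdist_left_mult[of "p i" x "inv (p i)"] p(1) x by simp
    then have "inv (p i) \<otimes> x = \<one>"
      using assms(3) i p(1) x by simp
    then have "p i \<otimes> (inv (p i) \<otimes> x) = p i" using p(1) by simp
    then have "x = p i" using p(1) x by (simp add: m_assoc[symmetric])
    then show ?thesis by blast
  qed
  then have "carrier G \<subseteq> range p" by blast
  then show ?thesis
    by (rule countable_subset) simp
qed

text \<open>
  The two points \<open>c\<close> and \<open>c g\<close> are at distance \<open>d \<one> g\<close> wherever \<open>c\<close> is, so \<open>q\<close> cannot be close to both.
  This uniformity in \<open>c\<close> is what a group without isolated points offers.
\<close>

lemma ex_point_away_from:
  assumes "g \<in> carrier G" "g \<noteq> \<one>" "d \<one> g < r / 2" "c \<in> carrier G" "q \<in> carrier G"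
    and "0 < r'" "r' \<le> r / 4" "r' \<le> d \<one> g / 4"
  shows "\<exists>c'\<in>carrier G. d c c' + r' \<le> r \<and> 2 * r' \<le> d c' q"
proof -
  have eq: "d c (c \<otimes> g) = d \<one> g"
    using mdist_left_mult[of \<one> g c] assms by simp
  show ?thesis
  proof (cases "2 * r' \<le> d c q")
    case True
    then show ?thesis using assms by (intro bexI[of _ c]) auto
  next
    case False
    have "d c (c \<otimes> g) \<le> d c q + d (c \<otimes> g) q"
      using triangle'[of c q "c \<otimes> g"] assms by simp
    then have "2 * r' \<le> d (c \<otimes> g) q"
      using False eq assms by linarith
    then show ?thesis
      using eq assms by (intro bexI[of _ "c \<otimes> g"]) auto
  qed
qed

end

section \<open>Meager-additive sets have sharp measure zero\<close>

context Metric_space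
begin

lemma ex_finite_net:
  assumes "compactin mtopology K" "0 < r" "M \<noteq> {}"
  obtains w :: "nat \<Rightarrow> 'a" and s where "0 < s" "\<And>a. w a \<in> M" "\<And>y. y \<in> K \<Longrightarrow> \<exists>a<s. d y (w a) < r"
proof -
  obtain L where L: "finite L" "L \<subseteq> K" "K \<subseteq> (\<Union>x\<in>L. mball x r)"
    using compactin_imp_mtotally_bounded[OF assms(1), unfolded mtotally_bounded_def, rule_format, OF assms(2)]
    by blast
  obtain x0 where x0: "x0 \<in> M" using assms(3) by blast
  obtain xs where xs: "set xs = L" using finite_list[OF L(1)] by blast
  define w where "w a = (if a < length xs then xs ! a else x0)" for a
  have LM: "L \<subseteq> M" using L(2) compactin_subset_topspace[OF assms(1)] by auto
  show thesis
  proof (rule that[of "Suc (length xs)" w])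
    show "0 < Suc (length xs)" by simp
    show "w a \<in> M" for a
    proof (cases "a < length xs")
      case True
      then have "xs ! a \<in> L" using xs nth_mem by blast
      with True LM show ?thesis by (auto simp: w_def)
    qed (simp add: w_def x0)
    fix y assume "y \<in> K"
    then obtain x where x: "x \<in> L" "y \<in> mball x r" using L(3) by blast
    then have "x \<in> set xs" using xs by simp
    then obtain a where a: "a < length xs" "xs ! a = x"
      unfolding in_set_conv_nth by blast
    then show "\<exists>a<Suc (length xs). d y (w a) < r"
      using x by (intro exI[of _ a]) (simp add: w_def commute)
  qed
qed

end

context invariant_metric_group
begin

text \<open>
  The parameters of the construction. Level \<open>k\<close> has a radius \<open>r k\<close>, an \<open>r k / 2\<close>-net \<open>w k\<close> of \<open>K k\<close> with \<open>S k\<close>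
  points, and the first index \<open>e k\<close> of the level. They must be chosen together: \<open>S k\<close> depends on \<open>r k\<close>, and
  \<open>r (Suc k)\<close> has to be small for all indices up to the end of level \<open>k\<close>. Increasing \<open>S\<close>
  ensures that a net taken at the start of a block fits into every level of the block.
\<close>

lemma ex_scales:
  fixes \<epsilon> :: "nat \<Rightarrow> real" and K :: "nat \<Rightarrow> 'a set"
  assumes nondiscrete: "\<And>r. 0 < r \<Longrightarrow> \<exists>g\<in>carrier G. g \<noteq> \<one> \<and> d \<one> g < r"
    and K: "\<And>k. compactin mtopology (K k)" and R: "0 < R" and \<epsilon>: "\<And>n. 0 < \<epsilon> n"
  obtains r :: "nat \<Rightarrow> real" and S e :: "nat \<Rightarrow> nat" and w :: "nat \<Rightarrow> nat \<Rightarrow> 'a"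
  where "\<And>k. 0 < r k" "r 0 \<le> R" "\<And>k. r (Suc k) \<le> r k / 4"
    and "\<And>k. 0 < S k" "\<And>k. S k \<le> S (Suc k)" "\<And>k. e (Suc k) = e k + S k"
    and "\<And>k n. n < e (Suc k) \<Longrightarrow> 4 * r (Suc k) \<le> \<epsilon> n"
    and "\<And>k a. w k a \<in> carrier G" "\<And>k y. y \<in> K k \<Longrightarrow> \<exists>a<S k. d y (w k a) < r k / 2"
    and "\<And>k c q. \<lbrakk>c \<in> carrier G; q \<in> carrier G\<rbrakk>
      \<Longrightarrow> \<exists>c'\<in>carrier G. d c c' + r (Suc k) \<le> r k \<and> 2 * r (Suc k) \<le> d c' q"
proof -
  define net where "net k r s \<longleftrightarrow>
      (\<exists>w :: nat \<Rightarrow> 'a. (\<forall>a. w a \<in> carrier G) \<and> (\<forall>y\<in>K k. \<exists>a<s. d y (w a) < r / 2))" for k r s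
  have ex_net: "\<exists>s\<ge>s0. 0 < s \<and> net k r s" if "0 < r" for k r s0
  proof -
    have "0 < r / 2" using that by simp
    then obtain w :: "nat \<Rightarrow> 'a" and s where w: "0 < s" "\<And>a. w a \<in> carrier G"
      "\<And>y. y \<in> K k \<Longrightarrow> \<exists>a<s. d y (w a) < r / 2"
      by (rule ex_finite_net[OF K _ carrier_not_empty]) blast
    have "net k r (max s s0)"
      unfolding net_def
    proof (intro exI[of _ w] conjI ballI allI)
      fix y assume "y \<in> K k"
      then obtain a where "a < s" "d y (w a) < r / 2" using w(3) by blast
      then show "\<exists>a<max s s0. d y (w a) < r / 2" by (intro exI[of _ a]) auto
    qed (rule w(2))
    then show ?thesis using w(1) by (intro exI[of _ "max s s0"]) auto
  qed
  define far where "far r r' \<longleftrightarrow> (\<forall>c\<in>carrier G. \<forall>q\<in>carrier G.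
      \<exists>c'\<in>carrier G. d c c' + r' \<le> r \<and> 2 * r' \<le> d c' q)" for r r'
  have ex_far: "\<exists>r'>0. r' \<le> r / 4 \<and> (\<forall>n<N. 4 * r' \<le> \<epsilon> n) \<and> far r r'" if "0 < r" for r N
  proof -
    have "0 < r / 2" using that by simp
    then obtain g where g: "g \<in> carrier G" "g \<noteq> \<one>" "d \<one> g < r / 2"
      using nondiscrete by blast
    obtain \<eta> where \<eta>: "\<eta> > 0" "\<forall>n<N. \<eta> \<le> \<epsilon> n"
      using ex_positive_lower_bound[of \<epsilon> N] \<epsilon> by blast
    define r' where "r' = min (\<eta> / 4) (min (r / 4) (d \<one> g / 4))"
    have "0 < d \<one> g" using g mdist_pos_less[of \<one> g] by auto
    then have r': "0 < r'" "r' \<le> r / 4" "r' \<le> d \<one> g / 4" "4 * r' \<le> \<eta>"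
      using that \<eta>(1) by (auto simp: r'_def)
    then have "far r r'"
      unfolding far_def using ex_point_away_from[OF g] by blast
    then show ?thesis using r' \<eta>(2) by (intro exI[of _ r']) force
  qed
  define good where "good k x \<longleftrightarrow> (case x of (r, s, e) \<Rightarrow>
      0 < r \<and> (k = 0 \<longrightarrow> r \<le> R) \<and> 0 < s \<and> net k r s)" for k and x :: "real \<times> nat \<times> nat"
  define next_scale where "next_scale x y \<longleftrightarrow> (case x of (r, s, e) \<Rightarrow> case y of (r', s', e') \<Rightarrow>
      r' \<le> r / 4 \<and> s \<le> s' \<and> e' = e + s \<and> (\<forall>n<e'. 4 * r' \<le> \<epsilon> n) \<and> far r r')"
    for x y :: "real \<times> nat \<times> nat"
  have "\<exists>f. \<forall>k. good k (f k) \<and> next_scale (f k) (f (Suc k))"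
  proof (rule dependent_nat_choice)
    obtain s where "0 < s" "net 0 R s" using ex_net[OF R, of 0 0] by blast
    then show "\<exists>x. good 0 x"
      using R by (intro exI[of _ "(R, s, 0)"]) (simp add: good_def)
    fix x k assume x: "good k x"
    obtain r s e where eq: "x = (r, s, e)" by (cases x)
    obtain r' where r': "0 < r'" "r' \<le> r / 4" "\<forall>n<e + s. 4 * r' \<le> \<epsilon> n" "far r r'"
      using ex_far[of r "e + s"] x eq by (auto simp: good_def)
    obtain s' where s': "s \<le> s'" "0 < s'" "net (Suc k) r' s'"
      using ex_net[OF r'(1), of s "Suc k"] by blast
    show "\<exists>y. good (Suc k) y \<and> next_scale x y"
      using r' s' by (intro exI[of _ "(r', s', e + s)"]) (simp add: good_def next_scale_def eq)
  qed
  then obtain f where f: "\<And>k. good k (f k)" "\<And>k. next_scale (f k) (f (Suc k))"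
    by blast
  define r where "r k = fst (f k)" for k
  define S where "S k = fst (snd (f k))" for k
  define e where "e k = snd (snd (f k))" for k
  have 1: "0 < r k" "k = 0 \<longrightarrow> r k \<le> R" "0 < S k" "net k (r k) (S k)" for k
    using f(1)[of k] by (simp_all add: good_def r_def S_def split_beta)
  have 2: "r (Suc k) \<le> r k / 4" "S k \<le> S (Suc k)" "e (Suc k) = e k + S k"
    "\<forall>n<e (Suc k). 4 * r (Suc k) \<le> \<epsilon> n" "far (r k) (r (Suc k))" for k
    using f(2)[of k] by (simp_all add: next_scale_def r_def S_def e_def split_beta)
  have "\<exists>w :: nat \<Rightarrow> nat \<Rightarrow> 'a. \<forall>k. (\<forall>a. w k a \<in> carrier G) \<and> (\<forall>y\<in>K k. \<exists>a<S k. d y (w k a) < r k / 2)"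
  proof (rule choice, rule allI)
    show "\<exists>w. (\<forall>a. w a \<in> carrier G) \<and> (\<forall>y\<in>K k. \<exists>a<S k. d y (w a) < r k / 2)" for k
      using 1(4)[of k] unfolding net_def .
  qed
  then obtain w :: "nat \<Rightarrow> nat \<Rightarrow> 'a"
    where w: "\<And>k. (\<forall>a. w k a \<in> carrier G) \<and> (\<forall>y\<in>K k. \<exists>a<S k. d y (w k a) < r k / 2)"
    by blast
  show thesis
  proof (rule that[of r S e w])
    show "r 0 \<le> R" using 1(2)[of 0] by simp
    show "\<exists>c'\<in>carrier G. d c c' + r (Suc k) \<le> r k \<and> 2 * r (Suc k) \<le> d c' q"
      if "c \<in> carrier G" "q \<in> carrier G" for k c q
      using 2(5)[of k] that unfolding far_def by blast
    show "4 * r (Suc k) \<le> \<epsilon> n" if "n < e (Suc k)" for k n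
      using 2(4)[of k] that by blast
  qed (use 1 2 w in auto)
qed

lemma nowhere_dense_complement_of_balls:
  assumes p: "\<And>i. p i \<in> carrier G" "\<And>x r. x \<in> carrier G \<Longrightarrow> 0 < r \<Longrightarrow> \<exists>i. d (p i) x < r"
    and r: "\<And>i. 0 < r i"
  shows "nowhere_dense_in mtopology (carrier G - (\<Union>i. mball (p i) (r i)))"
  unfolding nowhere_dense_in_iff_ball
proof (intro conjI ballI allI impI)
  fix c and s :: real assume c: "c \<in> carrier G" and s: "0 < s"
  obtain i where i: "d (p i) c < s / 2" using p(2)[OF c, of "s / 2"] s by auto
  define r' where "r' = min (s / 2) (r i / 2)"
  have "mcball (p i) r' \<subseteq> mball (p i) (r i)"
    using r[of i] by (intro mcball_subset_mball_concentric) (auto simp: r'_def)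
  then have "mcball (p i) r' \<inter> (carrier G - (\<Union>i. mball (p i) (r i))) = {}" by blast
  moreover have "0 < r'" "r' \<le> s / 2" using s r[of i] by (auto simp: r'_def)
  ultimately show "\<exists>c'\<in>carrier G. \<exists>r'>0. d c c' + r' \<le> s \<and>
      mcball c' r' \<inter> (carrier G - (\<Union>i. mball (p i) (r i))) = {}"
    using i p(1)[of i] commute[of c "p i"] by (intro bexI[of _ "p i"] exI[of _ r']) auto
qed blast

text \<open>
  From radius \<open>r l\<close> to radius \<open>r u\<close> one can stay away from the points \<open>p k\<close> with \<open>l \<le> k < u\<close>. The summand \<open>r u\<close> in
  the last bound keeps the whole ball of radius \<open>r u\<close> around \<open>z'\<close> outside the balls around the \<open>p k\<close>.
\<close>

lemma avoid_successively:
  assumes far: "\<And>k c q. \<lbrakk>c \<in> carrier G; q \<in> carrier G\<rbrakk>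
      \<Longrightarrow> \<exists>c'\<in>carrier G. d c c' + r (Suc k) \<le> r k \<and> 2 * r (Suc k) \<le> d c' q"
    and p: "\<And>k. p k \<in> carrier G" and z: "z \<in> carrier G" and "l \<le> u"
  shows "\<exists>z'\<in>carrier G. d z z' + r u \<le> r l \<and> (\<forall>k\<in>{l..<u}. r (Suc k) + r u \<le> d z' (p k))"
  using \<open>l \<le> u\<close>
proof (induction u rule: dec_induct)
  case base
  show ?case using z by (intro bexI[of _ z]) auto
next
  case (step u)
  then obtain z' where z': "z' \<in> carrier G" "d z z' + r u \<le> r l"
    "\<And>k. k \<in> {l..<u} \<Longrightarrow> r (Suc k) + r u \<le> d z' (p k)"
    by blast
  obtain z'' where z'': "z'' \<in> carrier G" "d z' z'' + r (Suc u) \<le> r u" "2 * r (Suc u) \<le> d z'' (p u)"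
    using far[OF z'(1) p, of u u] by blast
  have "r (Suc k) + r (Suc u) \<le> d z'' (p k)" if "k \<in> {l..<Suc u}" for k
  proof (cases "k = u")
    case True
    then show ?thesis using z''(3) by simp
  next
    case False
    then have "r (Suc k) + r u \<le> d z' (p k)" using z'(3) that by auto
    moreover have "d z' (p k) \<le> d z' z'' + d z'' (p k)"
      using triangle z'(1) z''(1) p by blast
    ultimately show ?thesis using z''(2) by linarith
  qed
  moreover have "d z z'' \<le> d z z' + d z' z''"
    using triangle z z'(1) z''(1) by blast
  ultimately show ?case
    using z' z'' by (intro bexI[of _ z'']) auto
qed

lemma ex_shrunken_targets:
  fixes F :: "'a set" and w :: "nat \<Rightarrow> 'a"
  assumes F: "nowhere_dense_in mtopology F" and w: "\<And>a. w a \<in> carrier G" and "0 < \<rho>"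
    and r: "r \<longlonglongrightarrow> (0::real)"
  shows "\<exists>u c. l < u \<and> (\<forall>a. c a \<in> carrier G) \<and>
    (\<forall>a<s. d (w a) (c a) + r u \<le> \<rho> \<and> mcball (c a) (r u) \<inter> F = {})"
proof -
  have "\<exists>c t. c \<in> carrier G \<and> 0 < t \<and> d (w a) c + t \<le> \<rho> \<and> mcball c t \<inter> F = {}" for a
    using F[unfolded nowhere_dense_in_iff_ball, THEN conjunct2, rule_format, OF w \<open>0 < \<rho>\<close>] by blast
  then obtain c t where ct: "\<And>a. c a \<in> carrier G \<and> 0 < t a \<and> d (w a) (c a) + t a \<le> \<rho> \<and> mcball (c a) (t a) \<inter> F = {}"
    by metis
  obtain \<eta> where \<eta>: "\<eta> > 0" "\<forall>a<s. \<eta> \<le> t a"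
    using ex_positive_lower_bound[of t s] ct by blast
  have "\<forall>\<^sub>F u in sequentially. r u < \<eta>"
    using order_tendstoD(2)[OF r \<eta>(1)] .
  then obtain N where N: "\<And>u. u \<ge> N \<Longrightarrow> r u < \<eta>"
    unfolding eventually_sequentially by blast
  define u where "u = max N (Suc l)"
  have "r u < \<eta>" using N by (simp add: u_def)
  have "d (w a) (c a) + r u \<le> \<rho> \<and> mcball (c a) (r u) \<inter> F = {}" if "a < s" for a
  proof -
    have "r u \<le> t a" using \<eta>(2) that \<open>r u < \<eta>\<close> by fastforce
    then have "mcball (c a) (r u) \<subseteq> mcball (c a) (t a)" by (rule mcball_subset_concentric)
    then show ?thesis using ct[of a] \<open>r u \<le> t a\<close> by fastforce
  qed
  then show ?thesis
    using ct by (intro exI[of _ u] exI[of _ c]) (auto simp: u_def)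
qed

text \<open>
  The blocks of levels and the gaps of the sets \<open>F\<close>: each net ball at the first level of block \<open>i\<close> contains
  a gap of \<open>F i\<close> with centre \<open>C i a\<close>, and the block is long enough for the gaps to have the radius
  that belongs to the next block.
\<close>

lemma ex_targets:
  fixes F :: "nat \<Rightarrow> 'a set" and w :: "nat \<Rightarrow> nat \<Rightarrow> 'a"
  assumes F: "\<And>i. nowhere_dense_in mtopology (F i)" and w: "\<And>k a. w k a \<in> carrier G"
    and r: "r \<longlonglongrightarrow> (0::real)" "\<And>k. 0 < r k"
  obtains b :: "nat \<Rightarrow> nat" and C :: "nat \<Rightarrow> nat \<Rightarrow> 'a"
  where "b 0 = 0" "strict_mono b" "\<And>i a. C i a \<in> carrier G"
    and "\<And>i a. a < S (b i) \<Longrightarrow> d (w (b i) a) (C i a) + r (b (Suc i)) \<le> r (b i) / 2"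
    and "\<And>i a. a < S (b i) \<Longrightarrow> mcball (C i a) (r (b (Suc i))) \<inter> F i = {}"
proof -
  have "\<forall>l. \<forall>i. \<exists>u c. l < u \<and> (\<forall>a. c a \<in> carrier G) \<and>
    (\<forall>a<S l. d (w l a) (c a) + r u \<le> r l / 2 \<and> mcball (c a) (r u) \<inter> F i = {})"
  proof (intro allI)
    fix l i
    have "0 < r l / 2" using r(2) by simp
    from ex_shrunken_targets[where w = "w l", OF F w this r(1)]
    show "\<exists>u c. l < u \<and> (\<forall>a. c a \<in> carrier G) \<and>
      (\<forall>a<S l. d (w l a) (c a) + r u \<le> r l / 2 \<and> mcball (c a) (r u) \<inter> F i = {})" .
  qed
  then obtain u c where uc: "\<And>l i. l < u l i \<and> (\<forall>a. c l i a \<in> carrier G) \<and>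
    (\<forall>a<S l. d (w l a) (c l i a) + r (u l i) \<le> r l / 2 \<and> mcball (c l i a) (r (u l i)) \<inter> F i = {})"
    by metis
  define b where "b = rec_nat 0 (\<lambda>i l. u l i)"
  have b: "b 0 = 0" "b (Suc i) = u (b i) i" for i by (simp_all add: b_def)
  show thesis
  proof (rule that[of b "\<lambda>i. c (b i) i"])
    show "strict_mono b" using uc by (simp add: strict_mono_Suc_iff b(2))
  qed (use uc b in auto)
qed

text \<open>
  The fusion argument. The point \<open>z\<close> is a limit of centres of nested balls, one ball for each block. In a
  block where \<open>x\<close> is missed, the net point near \<open>z x\<close> gives a gap of \<open>F i\<close> with centre \<open>C i a\<close>, and the
  centre moves to \<open>C i a x\<inverse>\<close>. That \<open>x\<close> is missed says exactly that this point is far from each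
  \<open>p k\<close> of the block.
\<close>

lemma translate_escapes:
  fixes F :: "nat \<Rightarrow> 'a set"
  assumes R: "compactin mtopology (mcball \<one> R)"
    and r: "\<And>k. 0 < r k" "r 0 \<le> R" "antimono r"
    and S: "mono S"
    and p: "\<And>k. p k \<in> carrier G"
    and far: "\<And>k c q. \<lbrakk>c \<in> carrier G; q \<in> carrier G\<rbrakk>
      \<Longrightarrow> \<exists>c'\<in>carrier G. d c c' + r (Suc k) \<le> r k \<and> 2 * r (Suc k) \<le> d c' q"
    and w: "\<And>k a. w k a \<in> carrier G"
    and b: "b 0 = 0" "strict_mono b"
    and C: "\<And>i a. C i a \<in> carrier G"
      "\<And>i a. a < S (b i) \<Longrightarrow> d (w (b i) a) (C i a) + r (b (Suc i)) \<le> r (b i) / 2"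
      "\<And>i a. a < S (b i) \<Longrightarrow> mcball (C i a) (r (b (Suc i))) \<inter> F i = {}"
    and F: "incseq F"
    and x: "x \<in> carrier G"
    and net: "\<And>k z. \<lbrakk>i0 \<le> k; z \<in> mcball \<one> R\<rbrakk> \<Longrightarrow> \<exists>a<S k. d (z \<otimes> x) (w k a) < r k / 2"
    and bad: "\<exists>\<^sub>F i in sequentially. \<forall>k\<in>{b i..<b (Suc i)}. \<forall>a<S k.
        2 * r (Suc k) \<le> d (inv (p k) \<otimes> C i a) x"
  shows "\<exists>z\<in>carrier G - (\<Union>k. mball (p k) (r (Suc k))). z \<otimes> x \<notin> (\<Union>i. F i)"
proof -
  define isbad where "isbad i \<longleftrightarrow> (\<forall>k\<in>{b i..<b (Suc i)}. \<forall>a<S k.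
        2 * r (Suc k) \<le> d (inv (p k) \<otimes> C i a) x)" for i
  have bmono: "b i \<le> b (Suc i)" for i using b(2) by (simp add: strict_mono_less_eq)
  have bi: "i \<le> b i" for i using b(2) by (rule strict_mono_imp_increasing)
  define inside where "inside i z \<longleftrightarrow> z \<in> carrier G \<and> d \<one> z + r (b i) \<le> R" for i z
  define goes where "goes i z z' \<longleftrightarrow> d z z' + r (b (Suc i)) \<le> r (b i) \<and>
      (\<forall>k\<in>{b i..<b (Suc i)}. r (Suc k) + r (b (Suc i)) \<le> d z' (p k)) \<and>
      (i0 \<le> i \<and> isbad i \<longrightarrow> (\<forall>y\<in>mcball z' (r (b (Suc i))). y \<otimes> x \<notin> F i))" for i z z'
  have step: "\<exists>z'\<in>carrier G. goes i z z'" if z: "inside i z" for i z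
  proof (cases "i0 \<le> i \<and> isbad i")
    case False
    have zG: "z \<in> carrier G" using z by (simp add: inside_def)
    show ?thesis
      using avoid_successively[of r p z "b i" "b (Suc i)", OF far p zG bmono] False
      unfolding goes_def by blast
  next
    case True
    have zG: "z \<in> carrier G" and zR: "z \<in> mcball \<one> R"
      using z r(1)[of "b i"] by (auto simp: inside_def)
    have "i0 \<le> b i" using True bi[of i] by linarith
    then obtain a where a: "a < S (b i)" "d (z \<otimes> x) (w (b i) a) < r (b i) / 2"
      using net zR by blast
    define z' where "z' = C i a \<otimes> inv x"
    have z'G: "z' \<in> carrier G" using C(1) x by (simp add: z'_def)
    have z'x: "z' \<otimes> x = C i a" using C(1) x by (simp add: z'_def m_assoc)
    have "d z z' = d (z \<otimes> x) (C i a)"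
      using mdist_right_mult[OF zG z'G x] z'x by simp
    also have "\<dots> \<le> d (z \<otimes> x) (w (b i) a) + d (w (b i) a) (C i a)"
      using triangle C(1) w zG x by simp
    finally have close: "d z z' + r (b (Suc i)) \<le> r (b i)"
      using a C(2)[OF a(1)] by linarith
    \<comment> \<open>Invariance turns the distance from \<open>x\<close> to the centre of the covering set into the distance from \<open>z'\<close> to \<open>p k\<close>.\<close>
    have away: "r (Suc k) + r (b (Suc i)) \<le> d z' (p k)" if k: "k \<in> {b i..<b (Suc i)}" for k
    proof -
      have "a < S k" using a(1) monoD[OF S, of "b i" k] k by auto
      then have "2 * r (Suc k) \<le> d (inv (p k) \<otimes> C i a) x"
        using True k unfolding isbad_def by blast
      also have "d (inv (p k) \<otimes> C i a) x = d (C i a) (p k \<otimes> x)"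
        using mdist_left_mult[of "inv (p k) \<otimes> C i a" x "p k"] C(1) p x
        by (simp add: m_assoc[symmetric])
      also have "\<dots> = d z' (p k)"
        using mdist_right_mult[OF z'G p x] z'x by simp
      finally have "2 * r (Suc k) \<le> d z' (p k)" .
      moreover have "r (b (Suc i)) \<le> r (Suc k)"
        using antimonoD[OF r(3), of "Suc k" "b (Suc i)"] k by simp
      ultimately show ?thesis by linarith
    qed
    have "y \<otimes> x \<notin> F i" if y: "y \<in> mcball z' (r (b (Suc i)))" for y
    proof -
      have "d (C i a) (y \<otimes> x) = d z' y"
        using mdist_right_mult[OF z'G _ x, of y] y z'x by simp
      then have "y \<otimes> x \<in> mcball (C i a) (r (b (Suc i)))"
        using y x C(1) by simp
      then show ?thesis using C(3)[OF a(1)] by blast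
    qed
    then have "goes i z z'" using close away unfolding goes_def by blast
    with z'G show ?thesis by blast
  qed
  have "\<exists>z. \<forall>i. inside i (z i) \<and> goes i (z i) (z (Suc i))"
  proof (rule dependent_nat_choice)
    show "\<exists>z. inside 0 z" using r(2) b(1) by (intro exI[of _ \<one>]) (simp add: inside_def)
    fix z i assume z: "inside i z"
    then obtain z' where z': "z' \<in> carrier G" "goes i z z'" using step by blast
    have "d \<one> z' \<le> d \<one> z + d z z'"
      using triangle z z' by (simp add: inside_def)
    moreover have "d z z' + r (b (Suc i)) \<le> r (b i)" using z'(2) by (simp add: goes_def)
    ultimately have "inside (Suc i) z'"
      using z z'(1) by (simp add: inside_def)
    then show "\<exists>z'. inside (Suc i) z' \<and> goes i z z'" using z'(2) by blast
  qed
  then obtain z where z: "\<And>i. inside i (z i)" "\<And>i. goes i (z i) (z (Suc i))" by blast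
  have zG: "z i \<in> carrier G" for i using z(1) by (simp add: inside_def)
  have "\<exists>l\<in>carrier G. \<forall>i. d (z i) l \<le> r (b i)"
  proof (rule nested_mcballs_common_point[OF R zG])
    show "d \<one> (z 0) + r (b 0) \<le> R" using z(1)[of 0] by (simp add: inside_def)
    show "d (z i) (z (Suc i)) + r (b (Suc i)) \<le> r (b i)" for i
      using z(2)[of i] by (simp add: goes_def)
    show "0 \<le> r (b i)" for i using r(1) by (simp add: less_imp_le)
  qed simp
  then obtain l where l: "l \<in> carrier G" "\<And>i. d (z i) l \<le> r (b i)" by blast
  have "l \<notin> mball (p k) (r (Suc k))" for k
  proof -
    obtain i where i: "k \<in> {b i..<b (Suc i)}"
      using block_exists[OF b(2), of k] b(1) by auto
    then have "r (Suc k) + r (b (Suc i)) \<le> d (z (Suc i)) (p k)"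
      using z(2)[of i] unfolding goes_def by blast
    moreover have "d (z (Suc i)) (p k) \<le> d (z (Suc i)) l + d (p k) l"
      using triangle'[OF zG l(1) p] .
    ultimately have "r (Suc k) \<le> d (p k) l" using l(2)[of "Suc i"] by linarith
    then show ?thesis by simp
  qed
  moreover have "l \<otimes> x \<notin> F j" for j
  proof -
    obtain i where i: "i \<ge> max i0 j" "isbad i"
      using bad unfolding frequently_sequentially isbad_def by blast
    have "l \<in> mcball (z (Suc i)) (r (b (Suc i)))"
      using l zG by simp
    then have "l \<otimes> x \<notin> F i"
      using z(2)[of i] i unfolding goes_def by simp
    moreover have "F j \<subseteq> F i" using incseqD[OF F, of j i] i(1) by simp
    ultimately show ?thesis by blast
  qed
  ultimately show ?thesis using l(1) by (intro bexI[of _ l]) auto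
qed

text \<open>
  The covering sets at level \<open>k\<close> are balls around \<open>p k\<inverse> C i a\<close>, where \<open>i\<close> is the block of \<open>k\<close>. If some point
  were missed in infinitely many blocks, the previous lemma would give a point of \<open>N X\<close> outside
  all the sets \<open>F i\<close> that cover \<open>N X\<close>.
\<close>

theorem meager_additive_imp_sharp_measure_zero:
  assumes lc: "locally_compact_space mtopology" and sep: "separable_space mtopology"
    and X: "meager_additive G mtopology X"
  shows "sharp_measure_zero m X"
proof -
  have XG: "X \<subseteq> carrier G" using X by (simp add: meager_additive_def)
  show ?thesis
  proof (cases "\<exists>r>0. \<forall>y\<in>carrier G. d \<one> y < r \<longrightarrow> y = \<one>")
    case True
    then obtain r where r: "0 < r" "\<forall>y\<in>carrier G. d \<one> y < r \<longrightarrow> y = \<one>" by blast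
    have "countable (carrier G)"
      by (rule discrete_imp_countable[OF sep r(1)]) (use r(2) in blast)
    with XG have "countable X" by (rule countable_subset)
    then show ?thesis
      using countable_imp_sharp_measure_zero[of X m] XG by (simp add: mspace_eq)
  next
    case False
    then have nondiscrete: "\<exists>g\<in>carrier G. g \<noteq> \<one> \<and> d \<one> g < r" if "0 < r" for r
      using that by blast
    obtain R' where R': "0 < R'" "\<And>g. g \<in> carrier G \<Longrightarrow> compactin mtopology (mcball g R')"
      by (rule compact_mcballs[OF lc]) blast
    \<comment> \<open>With half the radius, \<open>z x\<close> stays in a compact ball for \<open>z\<close> near \<open>\<one>\<close> and \<open>x\<close> near some \<open>p i\<close>.\<close>
    define R where "R = R' / 2"
    have R: "0 < R" using R'(1) by (simp add: R_def)
    have R1: "compactin mtopology (mcball \<one> R)"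
      by (rule closed_compactin[OF R'(2)[OF one_closed]])
        (use R'(1) in \<open>auto simp: R_def\<close>)
    obtain p :: "nat \<Rightarrow> 'a" where p: "\<And>i. p i \<in> carrier G"
      "\<And>x r. x \<in> carrier G \<Longrightarrow> 0 < r \<Longrightarrow> \<exists>i. d (p i) x < r"
      by (rule separable_space_dense_sequence[OF sep carrier_not_empty]) blast
    \<comment> \<open>The net at level \<open>k\<close> has to serve every \<open>z x\<close> with \<open>z\<close> near \<open>\<one>\<close> and \<open>x\<close> near one of \<open>p 0, \<dots>, p k\<close>.\<close>
    define K where "K k = (\<Union>i\<le>k. mcball (p i) R')" for k
    have K: "compactin mtopology (K k)" for k
      unfolding K_def by (intro compactin_Union) (use R'(2) p(1) in auto)
    have in_K: "z \<otimes> x \<in> K k" if "d (p i) x \<le> R" "i \<le> k" "x \<in> carrier G" "z \<in> mcball \<one> R" for i k x z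
    proof -
      have zG: "z \<in> carrier G" "d \<one> z \<le> R" using that by auto
      have "d x (z \<otimes> x) = d \<one> z"
        using mdist_right_mult[OF one_closed zG(1) that(3)] that(3) by simp
      moreover have "d (p i) (z \<otimes> x) \<le> d (p i) x + d x (z \<otimes> x)"
        using triangle p(1) that(3) zG(1) by simp
      ultimately have "d (p i) (z \<otimes> x) \<le> R'"
        using that(1) zG(2) by (simp add: R_def)
      then have "z \<otimes> x \<in> mcball (p i) R'"
        using p(1) zG(1) that(3) by simp
      then show ?thesis unfolding K_def using that(2) by blast
    qed
    show ?thesis
    proof (rule sharp_measure_zero_from_levels)
      show "X \<subseteq> mspace m" using XG by (simp add: mspace_eq)
      fix \<epsilon> :: "nat \<Rightarrow> real" assume \<epsilon>: "\<And>n. 0 < \<epsilon> n"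
      obtain r S e w where r: "\<And>k. 0 < r k" "r 0 \<le> R" "\<And>k. r (Suc k) \<le> r k / 4"
        and S: "\<And>k. 0 < S k" "\<And>k. S k \<le> S (Suc k)" and e: "\<And>k. e (Suc k) = e k + S k"
        and small: "\<And>k n. n < e (Suc k) \<Longrightarrow> 4 * r (Suc k) \<le> \<epsilon> n"
        and w: "\<And>k a. w k a \<in> carrier G"
        and net: "\<And>k y. y \<in> K k \<Longrightarrow> \<exists>a<S k. d y (w k a) < r k / 2"
        and far: "\<And>k c q. \<lbrakk>c \<in> carrier G; q \<in> carrier G\<rbrakk>
          \<Longrightarrow> \<exists>c'\<in>carrier G. d c c' + r (Suc k) \<le> r k \<and> 2 * r (Suc k) \<le> d c' q"
      proof (rule ex_scales[where K = K and \<epsilon> = \<epsilon>, OF nondiscrete K R \<epsilon>], goal_cases)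
        case (1 r)
        show ?case by (rule 1(2))
      next
        case (2 r S e w)
        show ?case by (rule 2(1)[OF 2(2-11)])
      qed
      have Smono: "mono S" using S(2) by (simp add: mono_iff_le_Suc)
      have anti: "antimono r"
        unfolding antimono_iff_le_Suc
      proof
        show "r (Suc k) \<le> r k" for k using r(1)[of k] r(3)[of k] by linarith
      qed
      have "r k \<le> r 0 * (1/4)^k" for k
      proof (induction k)
        case (Suc k)
        then show ?case using r(3)[of k] by simp
      qed simp
      moreover have "(\<lambda>k. r 0 * (1/4)^k) \<longlonglongrightarrow> 0"
        by (intro tendsto_mult_right_zero LIMSEQ_realpow_zero) auto
      ultimately have r0: "r \<longlonglongrightarrow> 0"
        using r(1) by (intro tendsto_sandwich[of "\<lambda>_. 0" r sequentially "\<lambda>k. r 0 * (1/4)^k" 0])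
          (auto simp: less_imp_le)
      define N where "N = carrier G - (\<Union>k. mball (p k) (r (Suc k)))"
      have "nowhere_dense_in mtopology N"
        unfolding N_def by (rule nowhere_dense_complement_of_balls[OF p]) (simp_all add: r(1))
      then have NX: "meager_in mtopology (N <#> X)"
        using X nowhere_dense_imp_meager_in unfolding meager_additive_def by blast
      obtain F :: "nat \<Rightarrow> 'a set" where F: "\<And>n. nowhere_dense_in mtopology (F n)"
        "incseq F" "N <#> X \<subseteq> (\<Union>n. F n)"
        by (rule meager_in_exhaustion[OF NX]) blast
      obtain b C where b: "b 0 = 0" "strict_mono b" and C: "\<And>i a. C i a \<in> carrier G"
        "\<And>i a. a < S (b i) \<Longrightarrow> d (w (b i) a) (C i a) + r (b (Suc i)) \<le> r (b i) / 2"
        "\<And>i a. a < S (b i) \<Longrightarrow> mcball (C i a) (r (b (Suc i))) \<inter> F i = {}"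
        by (rule ex_targets[of F w r S, OF F(1) w r0 r(1)]) blast
      define V where "V k a = (\<Union>i\<in>{i. k \<in> {b i..<b (Suc i)}}. mball (inv (p k) \<otimes> C i a) (2 * r (Suc k)))" for k a
      have V: "V k a = mball (inv (p k) \<otimes> C i a) (2 * r (Suc k))" if "k \<in> {b i..<b (Suc i)}" for k a i
      proof -
        have "{i. k \<in> {b i..<b (Suc i)}} = {i}"
          using block_unique[OF b(2), of _ k i] that by auto
        then show ?thesis by (simp add: V_def)
      qed
      have small_V: "diam_le m (\<epsilon> (e k + a)) (V k a)" if a: "a < S k" for k a
      proof -
        obtain i where i: "k \<in> {b i..<b (Suc i)}"
          using block_exists[OF b(2), of k] b(1) by auto
        have "4 * r (Suc k) \<le> \<epsilon> (e k + a)"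
          using small[of "e k + a" k] e a by simp
        moreover have "d x y \<le> 4 * r (Suc k)" if "x \<in> V k a" "y \<in> V k a" for x y
        proof -
          let ?q = "inv (p k) \<otimes> C i a"
          have "x \<in> carrier G" "y \<in> carrier G" "?q \<in> carrier G" "d ?q x < 2 * r (Suc k)" "d ?q y < 2 * r (Suc k)"
            using that V[OF i] by auto
          then show ?thesis using triangle''[of x ?q y] by linarith
        qed
        ultimately show ?thesis
          unfolding diam_le_def by force
      qed
      have cov: "\<forall>\<^sub>F i in sequentially. \<exists>k\<in>{b i..<b (Suc i)}. \<exists>a<S k. x \<in> V k a" if x: "x \<in> X" for x
      proof (rule ccontr)
        have xG: "x \<in> carrier G" using x XG by blast
        obtain i0 where i0: "d (p i0) x < R" using p(2)[OF xG R] by blast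
        assume "\<not> ?thesis"
        then have bad: "\<exists>\<^sub>F i in sequentially. \<forall>k\<in>{b i..<b (Suc i)}. \<forall>a<S k. x \<notin> V k a"
          by (simp add: not_eventually)
        have bad': "\<exists>\<^sub>F i in sequentially. \<forall>k\<in>{b i..<b (Suc i)}. \<forall>a<S k.
            2 * r (Suc k) \<le> d (inv (p k) \<otimes> C i a) x"
        proof (rule frequently_mono[OF _ bad], intro allI impI ballI)
          fix i k a
          assume "\<forall>k\<in>{b i..<b (Suc i)}. \<forall>a<S k. x \<notin> V k a" and k: "k \<in> {b i..<b (Suc i)}" and "a < S k"
          then have "x \<notin> V k a" by blast
          then show "2 * r (Suc k) \<le> d (inv (p k) \<otimes> C i a) x"
            using V[OF k, of a] p(1) C(1) xG by simp
        qed
        have net': "\<exists>a<S k. d (z \<otimes> x) (w k a) < r k / 2" if "i0 \<le> k" "z \<in> mcball \<one> R" for k z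
          using net[OF in_K[of i0 x k z]] that i0 xG by simp
        obtain z where z: "z \<in> N" "z \<otimes> x \<notin> (\<Union>i. F i)"
          using translate_escapes[of R r S p w b C F x i0, OF R1 r(1,2) anti Smono p(1) far w b C F(2) xG net' bad']
          unfolding N_def by blast
        then show False using F(3) x by (auto simp: set_mult_def)
      qed
      show "\<exists>e b S V. strict_mono b \<and> (\<forall>k. 0 < S k \<and> e (Suc k) = e k + S k) \<and>
        (\<forall>k. \<forall>a<S k. diam_le m (\<epsilon> (e k + a)) (V k a)) \<and>
        (\<forall>x\<in>X. \<forall>\<^sub>F i in sequentially. \<exists>k\<in>{b i..<b (Suc i)}. \<exists>a<S k. x \<in> V k a)"
      proof (rule exI[of _ e], rule exI[of _ b], rule exI[of _ S], rule exI[of _ V], intro conjI allI impI ballI)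
        show "strict_mono b" by (rule b(2))
        show "0 < S k" "e (Suc k) = e k + S k" for k by (rule S(1), rule e)
        show "diam_le m (\<epsilon> (e k + a)) (V k a)" if "a < S k" for k a using that by (rule small_V)
        show "\<forall>\<^sub>F i in sequentially. \<exists>k\<in>{b i..<b (Suc i)}. \<exists>a<S k. x \<in> V k a" if "x \<in> X" for x
          using that by (rule cov)
      qed
    qed
  qed
qed

end

section \<open>Meager-additive sets in products\<close>

lemma invariant_metric_groupI:
  assumes "topological_group G T" "invariant_metric G T m"
  shows "invariant_metric_group G m" and "mtopology_of m = T"
proof -
  interpret topological_group G T by (rule assms(1))
  show eq: "mtopology_of m = T"
    using assms(2) by (simp add: invariant_metric_def compatible_metric_def)
  have "mspace m = carrier G"
    using topspace_eq eq topspace_mtopology_of by metis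
  with assms(2) show "invariant_metric_group G m"
    unfolding invariant_metric_def by unfold_locales auto
qed

lemma invariant_metric_group_DirProd:
  assumes "invariant_metric_group G m1" "invariant_metric_group H m2"
  shows "invariant_metric_group (G \<times>\<times> H) (prod_metric m1 m2)"
proof -
  interpret A: invariant_metric_group G m1 by (rule assms(1))
  interpret B: invariant_metric_group H m2 by (rule assms(2))
  interpret group "G \<times>\<times> H" using DirProd_group A.is_group B.is_group .
  show ?thesis
    by unfold_locales
      (auto simp: DirProd_def A.mspace_eq B.mspace_eq prod_dist_def A.mdist_left_mult
        B.mdist_left_mult A.mdist_right_mult B.mdist_right_mult)
qed

theorem theorem6p2:
  fixes G1 :: "('a, 'c) monoid_scheme" and T1 :: "'a topology" and X1 :: "'a set"
    and G2 :: "('b, 'd) monoid_scheme" and T2 :: "'b topology" and X2 :: "'b set"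
  assumes "topological_group G1 T1" and "topological_group G2 T2"
    and "separable_space T1" and "separable_space T2"
    and "locally_compact_space T1" and "locally_compact_space T2"
    and "\<exists>d. invariant_metric G1 T1 d" and "\<exists>d. invariant_metric G2 T2 d"
    and "X1 \<subseteq> carrier G1" and "X2 \<subseteq> carrier G2"
  shows "(\<forall>d1 d. compatible_metric T1 d1 \<longrightarrow> compatible_metric (prod_topology T1 T2) d \<longrightarrow>
            strong_measure_zero d1 X1 \<longrightarrow> meager_additive G2 T2 X2 \<longrightarrow>
            strong_measure_zero d (X1 \<times> X2))
       \<and> (meager_additive G1 T1 X1 \<longrightarrow> meager_additive G2 T2 X2 \<longrightarrow>
            meager_additive (G1 \<times>\<times> G2) (prod_topology T1 T2) (X1 \<times> X2))"
proof -
  obtain m1 m2 where inv: "invariant_metric G1 T1 m1" "invariant_metric G2 T2 m2"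
    using assms(7,8) by blast
  have G1: "invariant_metric_group G1 m1" "mtopology_of m1 = T1"
    using invariant_metric_groupI[OF assms(1) inv(1)] by auto
  have G2: "invariant_metric_group G2 m2" "mtopology_of m2 = T2"
    using invariant_metric_groupI[OF assms(2) inv(2)] by auto
  interpret A: invariant_metric_group G1 m1 by (rule G1(1))
  interpret B: invariant_metric_group G2 m2 by (rule G2(1))
  interpret P: invariant_metric_group "G1 \<times>\<times> G2" "prod_metric m1 m2"
    using G1(1) G2(1) by (rule invariant_metric_group_DirProd)
  have T1: "A.mtopology = T1" and T2: "B.mtopology = T2"
    using A.mtopology_of_eq B.mtopology_of_eq G1(2) G2(2) by auto
  have T12: "P.mtopology = prod_topology T1 T2"
    using P.mtopology_of_eq G1(2) G2(2) by simp
  have \<sigma>: "sigma_compact (prod_topology T1 T2)"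
    using A.locally_compact_separable_imp_sigma_compact B.locally_compact_separable_imp_sigma_compact
      assms(3-6) by (simp add: T1 T2 sigma_compact_prod_topology)
  have sharp1: "sharp_measure_zero m1 X1" if "meager_additive G1 T1 X1"
    using A.meager_additive_imp_sharp_measure_zero that assms(3,5) by (simp add: T1)
  have sharp2: "sharp_measure_zero m2 X2" if "meager_additive G2 T2 X2"
    using B.meager_additive_imp_sharp_measure_zero that assms(4,6) by (simp add: T2)
  have "strong_measure_zero d (X1 \<times> X2)"
    if d1: "compatible_metric T1 d1" and d: "compatible_metric (prod_topology T1 T2) d"
      and X1: "strong_measure_zero d1 X1" and X2: "meager_additive G2 T2 X2" for d1 d
  proof (rule strong_measure_zero_change_metric)
    show "strong_measure_zero (prod_metric d1 m2) (X1 \<times> X2)"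
      using X1 sharp2[OF X2] by (rule strong_measure_zero_Times_sharp)
    show "mtopology_of (prod_metric d1 m2) = mtopology_of d"
      using d1 d G2(2) by (simp add: compatible_metric_def)
    show "sigma_compact (mtopology_of (prod_metric d1 m2))"
      using d1 G2(2) \<sigma> by (simp add: compatible_metric_def)
  qed
  moreover have "meager_additive (G1 \<times>\<times> G2) (prod_topology T1 T2) (X1 \<times> X2)"
    if "meager_additive G1 T1 X1" "meager_additive G2 T2 X2"
    using P.sharp_measure_zero_imp_meager_additive[unfolded T12, OF \<sigma> sharp_measure_zero_Times]
      sharp1[OF that(1)] sharp2[OF that(2)] by blast
  ultimately show ?thesis by blast
qed

end
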